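(* Let $k\ge 1$ and $n\ge 2k$ be integers. The delete-insert map $(i_1,\ldots,i_k)\mapsto (T_\lambda,P_\lambda)$ defined in the context is a bijection $$\{(i_1,\ldots,i_k)\ :\ 1\le i_j\le n \text{ for all } j\}\ \longrightarrow\ \bigsqcup_{\lambda\in\Lambda_n^k}\mathrm{SYT}(\lambda)\times \mathrm{VT}_k(\lambda).$$ Consequently $$n^k=\sum_{\lambda\in\Lambda_n^k} f^\lambda\, m_k^\lambda ,$$ where $f^\lambda=|\mathrm{SYT}(\lambda)|$ and $m_k^\lambda=|\mathrm{VT}_k(\lambda)|$.
   Context: Partitions are identified with their Young diagrams (English convention); $\lambda\vdash n$ means $\lambda$ is an integer partition of $n$, and $|\lambda|$ is its size. For partitions $\mu,\lambda$, $\mu\subseteq\lambda$ means containment of Young diagrams, and $\lambda/\mu$ is the set of boxes of $\lambda$ not in $\mu$. For integers $m\ge 1$, $i\ge 0$ put $\Lambda_m^i=\{\lambda\vdash m : |\lambda|-\lambda_1\le i\}$ (when $m=0$, the only partition of $m$ is the empty one). $\mathrm{SYT}(\lambda)$ is the set of standard Young tableaux of shape $\lambda\vdash n$ with entries $1,\ldots,n$. More generally, below a "tableau" is a filling of a Young diagram by distinct positive integers that increases along rows (left to right) and down columns. A vacillating tableau of shape $\lambda\in\Lambda_n^k$ and length $2k$ is a sequence of partitions $((n)=\lambda^{(0)},\lambda^{(1/2)},\lambda^{(1)},\lambda^{(3/2)},\ldots,\lambda^{(k-1/2)},\lambda^{(k)}=\lambda)$ such that for each integer $i$: (1) $\lambda^{(i)}\in\Lambda_n^i$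 and $\lambda^{(i+1/2)}\in\Lambda_{n-1}^i$; (2) $\lambda^{(i)}\supseteq\lambda^{(i+1/2)}$ and $|\lambda^{(i)}/\lambda^{(i+1/2)}|=1$; (3) $\lambda^{(i+1/2)}\subseteq\lambda^{(i+1)}$ and $|\lambda^{(i+1)}/\lambda^{(i+1/2)}|=1$. $\mathrm{VT}_k(\lambda)$ is the set of these. Jeu de taquin deletion of an entry $x$ from a tableau $T$: start with the box containing $x$; while that box is not a corner (a box at the end of both its row and its column), exchange $x$ with the smaller of the entries immediately below it and immediately to its right (if only one of these exists, exchange with that one); when $x$ is in a corner, delete that corner box. RSK (row) insertion of $x\notin S$ into a tableau $S$: let $R$ be the first row; while $x$ is less than some element of $R$, let $y$ be the smallest element of $R$ greater than $x$, replace $y$ in $R$ by $x$, set $x:=y$, and let $R$ be the next row; finally place $x$ at the end of $R$ (possibly an empty row). The delete-insert map: given $(i_1,\ldots,i_k)$ with $1\le i_j\le n$, let $T^{(0)}$ be the standard tableau of one-row shape $(n)$ with entries $1,2,\ldots,n$. For $0\le j\le k-1$, let $T^{(j+1/2)}$ be obtained from $T^{(j)}$ by jeu de taquin deletion of $i_{j+1}$, and let $T^{(j+1)}$ be obtained from $T^{(j+1/2)}$ by RSK insertion of $i_{j+1}$. Let $\lambda^{(j)}$, $\lambda^{(j+1/2)}$ be the shapes of $T^{(j)}$, $T^{(j+1/2)}$. Put $\lambda=\lambda^{(k)}$, $P_\lambda=(\lambda^{(0)},\lambda^{(1/2)},\lambda^{(1)},\ldots,\lambda^{(k)})$ and $T_\lambda=T^{(k)}$.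 *)

theory Defs
  imports Main
begin

text \<open>
  Partitions are weakly decreasing lists of positive parts, rows and columns of diagrams are
  numbered from 0 and a filling of a Young diagram is the list of its rows, without empty rows.
\<close>

definition partitions :: "nat \<Rightarrow> nat list set" where
  "partitions m = {lam. sorted_wrt (\<ge>) lam \<and> 0 \<notin> set lam \<and> sum_list lam = m}"

definition diagram :: "nat list \<Rightarrow> (nat \<times> nat) set" where
  "diagram lam = (SIGMA r:{..<length lam}. {..<lam ! r})"

definition first_part :: "nat list \<Rightarrow> nat" where
  "first_part lam = (case lam of [] \<Rightarrow> 0 | p # _ \<Rightarrow> p)"

definition Lam :: "nat \<Rightarrow> nat \<Rightarrow> nat list set" where
  "Lam m i = {lam \<in> partitions m. sum_list lam - first_part lam \<le> i}"


type_synonym filling = "nat list list"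

definition shape :: "filling \<Rightarrow> nat list" where
  "shape T = map length T"

definition entry :: "filling \<Rightarrow> nat \<times> nat \<Rightarrow> nat" where
  "entry T b = T ! fst b ! snd b"

definition entries :: "filling \<Rightarrow> nat set" where
  "entries T = entry T ` diagram (shape T)"

definition tableau :: "filling \<Rightarrow> bool" where
  "tableau T \<longleftrightarrow>
     shape T \<in> partitions (sum_list (shape T)) \<and>
     inj_on (entry T) (diagram (shape T)) \<and>
     0 \<notin> entries T \<and>
     (\<forall>r c. (r, Suc c) \<in> diagram (shape T) \<longrightarrow> entry T (r, c) < entry T (r, Suc c)) \<and>
     (\<forall>r c. (Suc r, c) \<in> diagram (shape T) \<longrightarrow> entry T (r, c) < entry T (Suc r, c))"

definition SYT :: "nat list \<Rightarrow> filling set" where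
  "SYT lam = {T. tableau T \<and> shape T = lam \<and> entries T = {1..sum_list lam}}"


text \<open>
  A vacillating tableau is the list of its partitions in order of their half-integral index:
  the partition with index \<open>i\<close> is at position \<open>2 * i\<close>, the one with index \<open>i + 1/2\<close> at
  position \<open>2 * i + 1\<close>.
\<close>

definition VT :: "nat \<Rightarrow> nat list \<Rightarrow> nat list list set" where
  "VT k lam = {P. length P = 2 * k + 1 \<and> P ! 0 = [sum_list lam] \<and> P ! (2 * k) = lam \<and>
     (\<forall>i\<le>k. P ! (2 * i) \<in> Lam (sum_list lam) i) \<and>
     (\<forall>i<k. P ! (2 * i + 1) \<in> Lam (sum_list lam - 1) i) \<and>
     (\<forall>i<k. diagram (P ! (2 * i + 1)) \<subseteq> diagram (P ! (2 * i)) \<and>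
            card (diagram (P ! (2 * i)) - diagram (P ! (2 * i + 1))) = 1) \<and>
     (\<forall>i<k. diagram (P ! (2 * i + 1)) \<subseteq> diagram (P ! (2 * i + 2)) \<and>
            card (diagram (P ! (2 * i + 2)) - diagram (P ! (2 * i + 1))) = 1)}"


definition set_entry :: "filling \<Rightarrow> nat \<times> nat \<Rightarrow> nat \<Rightarrow> filling" where
  "set_entry T b x = T[fst b := (T ! fst b)[snd b := x]]"

definition exchange :: "filling \<Rightarrow> nat \<times> nat \<Rightarrow> nat \<times> nat \<Rightarrow> filling" where
  "exchange T b b' = set_entry (set_entry T b (entry T b')) b' (entry T b)"

text \<open>Only meaningful if the last box of row \<open>r\<close> is a corner; a row that becomes empty is dropped.\<close>

definition delete_corner :: "filling \<Rightarrow> nat \<Rightarrow> filling" where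
  "delete_corner T r = filter (\<lambda>R. R \<noteq> []) (T[r := butlast (T ! r)])"

function jdt_slide :: "filling \<Rightarrow> nat \<Rightarrow> nat \<Rightarrow> filling" where
  "jdt_slide T r c =
     (if (Suc r, c) \<in> diagram (shape T) \<and>
         ((r, Suc c) \<in> diagram (shape T) \<longrightarrow> entry T (Suc r, c) < entry T (r, Suc c))
      then jdt_slide (exchange T (r, c) (Suc r, c)) (Suc r) c
      else if (r, Suc c) \<in> diagram (shape T)
      then jdt_slide (exchange T (r, c) (r, Suc c)) r (Suc c)
      else delete_corner T r)"
  by pat_completeness auto

lemma shape_set_entry [simp]: "shape (set_entry T b x) = shape T"
  unfolding shape_def set_entry_def
  by (metis length_list_update list_update_id map_update)

lemma shape_exchange [simp]: "shape (exchange T b b') = shape T"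
  by (simp add: exchange_def)

lemma diagram_bound: "(r, c) \<in> diagram lam \<Longrightarrow> r + c < length lam + sum_list lam"
  using member_le_sum_list[of "lam ! r" lam] by (auto simp: diagram_def)

termination jdt_slide
  by (relation "measure (\<lambda>(T, r, c). length (shape T) + sum_list (shape T) - (r + c))")
    (auto dest!: diagram_bound)

definition jdt_delete :: "nat \<Rightarrow> filling \<Rightarrow> filling" where
  "jdt_delete x T =
     (let b = (THE b. b \<in> diagram (shape T) \<and> entry T b = x) in jdt_slide T (fst b) (snd b))"

fun rsk_insert :: "nat \<Rightarrow> filling \<Rightarrow> filling" where
  "rsk_insert x [] = [[x]]"
| "rsk_insert x (R # Rs) =
     (if \<exists>z\<in>set R. x < z
      then let y = Min {z \<in> set R. x < z}
           in map (\<lambda>z. if z = y then x else z) R # rsk_insert y Rs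
      else (R @ [x]) # Rs)"


text \<open>The list of all \<open>2 * k + 1\<close> tableaux of a run on \<open>k\<close> indices, half steps included.\<close>

fun delete_insert_run :: "filling \<Rightarrow> nat list \<Rightarrow> filling list" where
  "delete_insert_run T [] = [T]"
| "delete_insert_run T (i # xs) =
     (let H = jdt_delete i T in T # H # delete_insert_run (rsk_insert i H) xs)"

text \<open>The result is tagged with the shape \<open>lam\<close>, naming its summand in the disjoint union.\<close>

definition delete_insert :: "nat \<Rightarrow> nat list \<Rightarrow> nat list \<times> filling \<times> nat list list" where
  "delete_insert n xs =
     (let Ts = delete_insert_run [[1..<Suc n]] xs
      in (shape (last Ts), last Ts, map shape Ts))"

end

theory Submission
  imports Defs
begin

text \<open>
  Both halves of a delete-insert step are reversible once the shape before the step is known. Row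
  insertion is undone by reverse bumping starting from the box that is lost. A jeu de taquin slide
  of \<open>x\<close> is undone by placing \<open>x\<close> in the added corner and exchanging it with the larger of its left
  and upper neighbours as long as that one exceeds \<open>x\<close>. Hence a run can be recovered from its
  final tableau and its sequence of shapes, and since the one-row shape carries only one standard
  tableau, every vacillating tableau together with a standard tableau of its shape arises.
  The bound on the boxes below the first row holds along every run, because a deletion does not
  increase their number and an insertion increases it by at most one.
\<close>

section \<open>Partitions and covers\<close>

text \<open>The two reversals must be made in one order. Undoing the insertion yields the half-step
  tableau together with the number \<open>x\<close> that was inserted into it; only with
  \<open>x\<close> known can the slide be undone. The lost corner says where \<open>x\<close>
  re-enters, and the values alone decide where it stops, so its original box need not be remembered.
  No inverse function is defined: each half step is shown to be injective for a prescribed earlier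
  shape and to reach every admissible result. The slide is the harder half, because its intermediate
  fillings are not tableaux. They satisfy a weaker invariant that exempts one box. Under this
  invariant a backward step is unique, and the fillings without a backward step are those that
  increase everywhere. Insertion recurses over rows whereas a slide wanders between boxes, hence the
  two descriptions \<open>tableau_rows\<close> and \<open>increasing\<close> of the same order
  conditions.\<close>

definition down_closed :: "(nat \<times> nat) set \<Rightarrow> bool" where
  "down_closed D \<longleftrightarrow> (\<forall>p\<in>D. \<forall>r c. r \<le> fst p \<longrightarrow> c \<le> snd p \<longrightarrow> (r, c) \<in> D)"

definition is_partition :: "nat list \<Rightarrow> bool" where
  "is_partition lam \<longleftrightarrow> sorted_wrt (\<ge>) lam \<and> 0 \<notin> set lam"

lemma partitions_iff: "lam \<in> partitions m \<longleftrightarrow> is_partition lam \<and> sum_list lam = m"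
  by (auto simp: partitions_def is_partition_def)

lemma mem_diagram: "(r, c) \<in> diagram lam \<longleftrightarrow> r < length lam \<and> c < lam ! r"
  by (auto simp: diagram_def)

lemma finite_diagram [simp]: "finite (diagram lam)"
  by (simp add: diagram_def)

lemma card_diagram: "card (diagram lam) = sum_list lam"
  by (simp add: diagram_def sum_list_sum_nth atLeast0LessThan)

lemma is_partition_Nil [simp]: "is_partition []"
  by (simp add: is_partition_def)

lemma is_partition_Cons:
  "is_partition (p # ps) \<longleftrightarrow> p > 0 \<and> (ps \<noteq> [] \<longrightarrow> hd ps \<le> p) \<and> is_partition ps"
  by (cases ps) (auto simp: is_partition_def)

lemma down_closed_diagram:
  assumes "is_partition lam" shows "down_closed (diagram lam)"
proof -
  have "lam ! r \<ge> lam ! r'" if "r \<le> r'" "r' < length lam" for r r'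
    using assms that unfolding is_partition_def sorted_wrt_iff_nth_less
    by (cases "r = r'") auto
  then show ?thesis
    unfolding down_closed_def by (fastforce simp: mem_diagram)
qed

fun add_box :: "nat \<Rightarrow> nat list \<Rightarrow> nat list" where
  "add_box r [] = [1]"
| "add_box 0 (p # ps) = Suc p # ps"
| "add_box (Suc r) (p # ps) = p # add_box r ps"

text \<open>Row indices beyond \<open>length mu\<close> would all name the same new bottom box, so
  the bound makes the index unique. Weak decrease of the result is not part of the relation;
  \<open>is_partition\<close> accompanies it where it matters.\<close>

definition covers :: "nat list \<Rightarrow> nat list \<Rightarrow> bool" where
  "covers mu lam \<longleftrightarrow> (\<exists>r\<le>length mu. lam = add_box r mu)"

lemma sum_list_add_box [simp]: "sum_list (add_box r mu) = Suc (sum_list mu)"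
  by (induction r mu rule: add_box.induct) auto

lemma diagram_add_box:
  "r \<le> length mu \<Longrightarrow>
    diagram (add_box r mu) = insert (r, if r < length mu then mu ! r else 0) (diagram mu)"
proof (induction r mu rule: add_box.induct)
  case (2 p ps)
  show ?case
  proof (rule set_eqI, clarify)
    fix a b show "((a, b) \<in> diagram (add_box 0 (p # ps))) \<longleftrightarrow>
      ((a, b) \<in> insert (0, if 0 < length (p # ps) then (p # ps) ! 0 else 0) (diagram (p # ps)))"
      by (cases a) (auto simp: mem_diagram)
  qed
next
  case (3 r p ps)
  have *: "(Suc a, b) \<in> diagram (q # qs) \<longleftrightarrow> (a, b) \<in> diagram qs" for a b q qs
    by (simp add: mem_diagram)
  show ?case
  proof (rule set_eqI, clarify)
    fix a b show "((a, b) \<in> diagram (add_box (Suc r) (p # ps))) \<longleftrightarrow>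
      ((a, b) \<in> insert (Suc r, if Suc r < length (p # ps) then (p # ps) ! Suc r else 0) (diagram (p # ps)))"
      using 3 by (cases a) (auto simp: * mem_diagram[of 0])
  qed
qed (auto simp: mem_diagram)

lemma new_box_notin: "(r, if r < length mu then mu ! r else 0) \<notin> diagram mu"
  by (simp add: mem_diagram)

text \<open>Equal sizes turn the inclusion into an equality of diagrams. As no part is zero, column
  0 then shows the number of rows, and each row shows its length.\<close>

lemma diagram_subset_eqI:
  assumes "is_partition mu" "is_partition lam" "diagram mu \<subseteq> diagram lam"
    "sum_list mu = sum_list lam"
  shows "mu = lam"
proof -
  have D: "diagram mu = diagram lam"
    using assms by (intro card_subset_eq) (auto simp: card_diagram)
  have pos: "0 \<notin> set mu" "0 \<notin> set lam" using assms by (auto simp: is_partition_def)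
  have r: "r < length nu \<longleftrightarrow> (r, 0) \<in> diagram nu" if "0 \<notin> set nu" for r and nu :: "nat list"
    using that by (auto simp: mem_diagram in_set_conv_nth)
  have len: "length mu = length lam"
    by (metis D linorder_neqE_nat nat_less_le r pos)
  show ?thesis
  proof (rule nth_equalityI[OF len])
    fix i assume "i < length mu"
    then have "c < mu ! i \<longleftrightarrow> c < lam ! i" for c
      using D len mem_diagram by metis
    then show "mu ! i = lam ! i"
      by (metis linorder_neqE_nat nat_less_le)
  qed
qed

text \<open>Either the first parts agree and the extra box lies further down, or the sizes leave
  room only for \<open>q = Suc p\<close>, and then the remaining rows coincide by
  \<open>diagram_subset_eqI\<close>.\<close>

lemma covers_if_subset_diagram:
  assumes "is_partition mu" "is_partition lam" "diagram mu \<subseteq> diagram lam"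
    "sum_list lam = Suc (sum_list mu)"
  shows "covers mu lam"
  using assms
proof (induction mu arbitrary: lam)
  case Nil
  then show ?case
    by (cases lam; cases "tl lam")
      (auto simp: covers_def is_partition_Cons is_partition_def)
next
  case (Cons p ps)
  then have "(0, 0) \<in> diagram (p # ps)" by (simp add: mem_diagram is_partition_Cons)
  then have "(0, 0) \<in> diagram lam" using Cons.prems by blast
  then obtain q qs where lam: "lam = q # qs" by (cases lam) (auto simp: mem_diagram)
  have sub: "diagram ps \<subseteq> diagram qs"
  proof clarify
    fix a b assume "(a, b) \<in> diagram ps"
    then have "(Suc a, b) \<in> diagram (p # ps)" by (simp add: mem_diagram)
    then have "(Suc a, b) \<in> diagram lam" using Cons.prems by blast
    then show "(a, b) \<in> diagram qs" by (simp add: lam mem_diagram)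
  qed
  have "(0, p - 1) \<in> diagram (p # ps)" using Cons.prems by (simp add: mem_diagram is_partition_Cons)
  then have "(0, p - 1) \<in> diagram lam" using Cons.prems by blast
  then have pq: "p \<le> q" by (simp add: lam mem_diagram)
  have part: "is_partition ps" "is_partition qs"
    using Cons.prems by (auto simp: lam is_partition_Cons)
  have le: "sum_list ps \<le> sum_list qs"
    using card_mono[OF _ sub] by (simp add: card_diagram)
  show ?case
  proof (cases "p = q")
    case True
    then have "covers ps qs" using Cons part sub by (simp add: lam)
    then obtain r where "r \<le> length ps" "qs = add_box r ps" by (auto simp: covers_def)
    then show ?thesis unfolding covers_def lam True by (intro exI[of _ "Suc r"]) simp
  next
    case False
    then have "q = Suc p" "sum_list ps = sum_list qs"
      using pq le Cons.prems(4) by (auto simp: lam)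
    then show ?thesis
      using diagram_subset_eqI[OF part sub]
      unfolding covers_def lam by (intro exI[of _ 0]) simp
  qed
qed

lemma covers_iff_diagram:
  assumes "is_partition mu" "is_partition lam"
  shows "covers mu lam \<longleftrightarrow>
    diagram mu \<subseteq> diagram lam \<and> card (diagram lam - diagram mu) = 1"
proof
  assume "covers mu lam"
  then show "diagram mu \<subseteq> diagram lam \<and> card (diagram lam - diagram mu) = 1"
    by (auto simp: covers_def diagram_add_box new_box_notin insert_Diff_if)
next
  assume *: "diagram mu \<subseteq> diagram lam \<and> card (diagram lam - diagram mu) = 1"
  then have "card (diagram lam) - card (diagram mu) = 1"
    using card_Diff_subset[of "diagram mu" "diagram lam"] by simp
  then show "covers mu lam"
    using * by (intro covers_if_subset_diagram assms) (auto simp: card_diagram)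
qed

text \<open>The sum of the tail counts the boxes below the first row, which is the quantity bounded
  in \<open>Lam\<close>. These two inequalities carry that bound through a deletion and an
  insertion.\<close>

lemma sum_list_tl_covers:
  assumes "covers mu lam"
  shows "sum_list (tl mu) \<le> sum_list (tl lam)" "sum_list (tl lam) \<le> Suc (sum_list (tl mu))"
proof -
  have "sum_list (tl mu) \<le> sum_list (tl (add_box r mu)) \<and>
      sum_list (tl (add_box r mu)) \<le> Suc (sum_list (tl mu))" for r
    by (cases "(r, mu)" rule: add_box.cases) auto
  then show "sum_list (tl mu) \<le> sum_list (tl lam)" "sum_list (tl lam) \<le> Suc (sum_list (tl mu))"
    using assms by (auto simp: covers_def)
qed

lemma Lam_iff: "lam \<in> Lam m i \<longleftrightarrow> is_partition lam \<and> sum_list lam = m \<and> sum_list (tl lam) \<le> i"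
  by (cases lam) (auto simp: Lam_def partitions_iff first_part_def)

lemma finite_Lam: "finite (Lam m i)"
proof (rule finite_subset)
  have "length lam \<le> sum_list lam" if "0 \<notin> set lam" for lam :: "nat list"
    using that by (induction lam) auto
  then show "Lam m i \<subseteq> {xs. set xs \<subseteq> {..m} \<and> length xs \<le> m}"
    by (auto simp: Lam_iff is_partition_def intro: member_le_sum_list)
qed (rule finite_lists_length_le, simp)

section \<open>Tableaux\<close>

lemma shape_simps [simp]:
  "shape [] = []" "shape (R # T) = length R # shape T"
  by (auto simp: shape_def)

lemma length_shape [simp]: "length (shape T) = length T"
  by (simp add: shape_def)

lemma entries_conv_concat: "entries T = set (concat T)"
proof
  show "set (concat T) \<subseteq> entries T"
  proof
    fix x assume "x \<in> set (concat T)"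
    then obtain r c where "r < length T" "c < length (T ! r)" "x = T ! r ! c"
      by (auto simp: in_set_conv_nth)
    then show "x \<in> entries T"
      unfolding entries_def entry_def
      by (intro image_eqI[of _ _ "(r, c)"]) (auto simp: mem_diagram shape_def)
  qed
next
  show "entries T \<subseteq> set (concat T)"
  proof
    fix x assume "x \<in> entries T"
    then obtain r c where "r < length T" "c < length (T ! r)" "x = T ! r ! c"
      by (auto simp: entries_def entry_def mem_diagram shape_def)
    then have "x \<in> set (T ! r)" "T ! r \<in> set T" by auto
    then show "x \<in> set (concat T)" by auto
  qed
qed

lemma card_entries_if_inj:
  "inj_on (entry T) (diagram (shape T)) \<Longrightarrow> card (entries T) = sum_list (shape T)"
  by (simp add: entries_def card_image card_diagram)

text \<open>Both sides say that there are as many values as boxes. This trades a condition on boxes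
  for one on \<open>concat T\<close>, which follows the recursion over rows.\<close>

lemma inj_on_entry_iff_distinct:
  "inj_on (entry T) (diagram (shape T)) \<longleftrightarrow> distinct (concat T)"
proof -
  have len: "length (concat T) = sum_list (shape T)"
    by (simp add: length_concat shape_def)
  have "inj_on (entry T) (diagram (shape T)) \<longleftrightarrow> card (entries T) = sum_list (shape T)"
    using card_entries_if_inj[of T]
    by (auto simp: card_diagram entries_def intro: eq_card_imp_inj_on)
  also have "\<dots> \<longleftrightarrow> distinct (concat T)"
    using card_distinct[of "concat T"] distinct_card[of "concat T"] len
    unfolding entries_conv_concat by metis
  finally show ?thesis .
qed

lemma filling_eqI:
  assumes "shape T = shape U" "\<And>b. b \<in> diagram (shape T) \<Longrightarrow> entry T b = entry U b"
  shows "T = U"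
proof (rule nth_equalityI)
  show "length T = length U" using assms(1) by (metis length_shape)
  fix r assume r: "r < length T"
  have len: "length (T ! r) = length (U ! r)"
    using assms(1) r \<open>length T = length U\<close> by (metis nth_map shape_def)
  show "T ! r = U ! r"
  proof (rule nth_equalityI[OF len])
    fix c assume "c < length (T ! r)"
    then have "(r, c) \<in> diagram (shape T)" using r by (simp add: mem_diagram shape_def)
    then show "T ! r ! c = U ! r ! c" using assms(2) by (force simp: entry_def)
  qed
qed

fun dominates :: "nat list \<Rightarrow> filling \<Rightarrow> bool" where
  "dominates R [] \<longleftrightarrow> True"
| "dominates R (R' # T) \<longleftrightarrow> length R' \<le> length R \<and> (\<forall>c<length R'. R ! c < R' ! c)"

text \<open>Follows the recursion of \<open>rsk_insert\<close>, each row being compared only with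
  the next one. Distinctness and positivity stay outside and are added in
  \<open>tableau_iff\<close>, because insertion preserves them by arguments about the set and number
  of entries alone.\<close>

fun tableau_rows :: "filling \<Rightarrow> bool" where
  "tableau_rows [] \<longleftrightarrow> True"
| "tableau_rows (R # T) \<longleftrightarrow> R \<noteq> [] \<and> sorted_wrt (<) R \<and> dominates R T \<and> tableau_rows T"

lemma mem_diagram_Cons:
  "(0, c) \<in> diagram (p # ps) \<longleftrightarrow> c < p"
  "(Suc r, c) \<in> diagram (p # ps) \<longleftrightarrow> (r, c) \<in> diagram ps"
  by (auto simp: mem_diagram)

lemma all_nat_split: "(\<forall>r. P r) \<longleftrightarrow> P 0 \<and> (\<forall>r. P (Suc r))" for P :: "nat \<Rightarrow> bool"
  by (metis not0_implies_Suc)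

lemma tableau_rows_iff:
  "tableau_rows T \<longleftrightarrow> is_partition (shape T) \<and>
     (\<forall>r c. (r, Suc c) \<in> diagram (shape T) \<longrightarrow> entry T (r, c) < entry T (r, Suc c)) \<and>
     (\<forall>r c. (Suc r, c) \<in> diagram (shape T) \<longrightarrow> entry T (r, c) < entry T (Suc r, c))"
proof (induction T)
  case (Cons R T)
  have row: "sorted_wrt (<) R \<longleftrightarrow> (\<forall>c. Suc c < length R \<longrightarrow> R ! c < R ! Suc c)"
    by (simp add: sorted_wrt_iff_nth_Suc_transp)
  have dom: "dominates R T \<longleftrightarrow> (shape T \<noteq> [] \<longrightarrow> hd (shape T) \<le> length R) \<and>
      (\<forall>c. (0, c) \<in> diagram (shape T) \<longrightarrow> R ! c < entry T (0, c))"
    by (cases T) (auto simp: mem_diagram entry_def)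
  have e: "entry (R # T) (0, c) = R ! c" "entry (R # T) (Suc r, c) = entry T (r, c)" for r c
    by (simp_all add: entry_def)
  have rows: "(\<forall>r c. (r, Suc c) \<in> diagram (shape (R # T)) \<longrightarrow>
        entry (R # T) (r, c) < entry (R # T) (r, Suc c)) \<longleftrightarrow>
      (\<forall>c. Suc c < length R \<longrightarrow> R ! c < R ! Suc c) \<and>
      (\<forall>r c. (r, Suc c) \<in> diagram (shape T) \<longrightarrow> entry T (r, c) < entry T (r, Suc c))"
    by (subst all_nat_split) (simp add: mem_diagram_Cons e)
  have cols: "(\<forall>r c. (Suc r, c) \<in> diagram (shape (R # T)) \<longrightarrow>
        entry (R # T) (r, c) < entry (R # T) (Suc r, c)) \<longleftrightarrow>
      (\<forall>c. (0, c) \<in> diagram (shape T) \<longrightarrow> R ! c < entry T (0, c)) \<and>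
      (\<forall>r c. (Suc r, c) \<in> diagram (shape T) \<longrightarrow> entry T (r, c) < entry T (Suc r, c))"
    by (subst all_nat_split) (simp add: mem_diagram_Cons e)
  show ?case
    unfolding rows cols by (auto simp: is_partition_Cons row dom Cons)
qed (auto simp: mem_diagram)

lemma tableau_iff:
  "tableau T \<longleftrightarrow> tableau_rows T \<and> distinct (concat T) \<and> 0 \<notin> set (concat T)"
  by (auto simp: tableau_def tableau_rows_iff partitions_iff inj_on_entry_iff_distinct
      entries_conv_concat)

lemma tableau_rows_partition: "tableau_rows T \<Longrightarrow> is_partition (shape T)"
  by (simp add: tableau_rows_iff)

lemma tableau_partition: "tableau T \<Longrightarrow> is_partition (shape T)"
  by (simp add: tableau_iff tableau_rows_partition)

section \<open>Row insertion\<close>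

definition bump :: "nat \<Rightarrow> nat list \<Rightarrow> nat" where
  "bump x R = Min {z \<in> set R. x < z}"

lemma bump_in: assumes "\<exists>z\<in>set R. x < z" shows "bump x R \<in> set R" "x < bump x R"
proof -
  have "bump x R \<in> {z \<in> set R. x < z}"
    unfolding bump_def using assms by (intro Min_in) auto
  then show "bump x R \<in> set R" "x < bump x R" by auto
qed

lemma bump_le: "z \<in> set R \<Longrightarrow> x < z \<Longrightarrow> bump x R \<le> z"
  by (simp add: bump_def)

lemma rsk_insert_Cons:
  "rsk_insert x (R # Rs) =
     (if \<exists>z\<in>set R. x < z
      then map (\<lambda>z. if z = bump x R then x else z) R # rsk_insert (bump x R) Rs
      else (R @ [x]) # Rs)"
  by (simp add: bump_def Let_def)

declare rsk_insert.simps(2) [simp del]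

lemma set_concat_rsk_insert: "set (concat (rsk_insert x T)) = insert x (set (concat T))"
proof (induction T arbitrary: x)
  case (Cons R T)
  show ?case
  proof (cases "\<exists>z\<in>set R. x < z")
    case True
    have "set (map (\<lambda>z. if z = bump x R then x else z) R) = insert x (set R - {bump x R})"
      using bump_in(1)[OF True] by auto
    then show ?thesis using True Cons bump_in(1)[OF True] by (auto simp: rsk_insert_Cons)
  qed (auto simp: rsk_insert_Cons)
qed simp

lemma shape_rsk_insert: "\<exists>r\<le>length T. shape (rsk_insert x T) = add_box r (shape T)"
proof (induction T arbitrary: x)
  case (Cons R T)
  show ?case
  proof (cases "\<exists>z\<in>set R. x < z")
    case True
    obtain r where "r \<le> length T" "shape (rsk_insert (bump x R) T) = add_box r (shape T)"
      using Cons by blast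
    then show ?thesis by (intro exI[of _ "Suc r"]) (simp add: rsk_insert_Cons True)
  next
    case False
    then show ?thesis by (intro exI[of _ 0]) (simp add: rsk_insert_Cons)
  qed
qed simp

lemma covers_rsk_insert: "covers (shape T) (shape (rsk_insert x T))"
  using shape_rsk_insert[of T x] by (simp add: covers_def)

text \<open>Insertion adds one value and one box, so the number of values still equals the number of
  boxes.\<close>

lemma distinct_concat_rsk_insert:
  assumes "distinct (concat T)" "x \<notin> set (concat T)"
  shows "distinct (concat (rsk_insert x T))"
proof (rule card_distinct)
  have len: "length (concat U) = sum_list (shape U)" for U :: filling
    by (simp add: length_concat shape_def)
  show "card (set (concat (rsk_insert x T))) = length (concat (rsk_insert x T))"
    unfolding set_concat_rsk_insert
    using assms shape_rsk_insert[of T x] len[of T] distinct_card[OF assms(1)]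
    by (auto simp: len simp del: set_concat)
qed

lemma sorted_map_replace:
  assumes "sorted_wrt (<) (R :: nat list)" "c < length R"
  shows "map (\<lambda>z. if z = R ! c then x else z) R = R[c := x]"
proof (rule nth_equalityI)
  have d: "distinct R" using assms(1) strict_sorted_iff by blast
  fix i assume "i < length (map (\<lambda>z. if z = R ! c then x else z) R)"
  then show "map (\<lambda>z. if z = R ! c then x else z) R ! i = R[c := x] ! i"
    using assms(2) d by (auto simp: nth_list_update nth_eq_iff_index_eq)
qed simp

lemma sorted_wrt_snocI: "sorted_wrt (<) (R :: nat list) \<Longrightarrow> (\<forall>z\<in>set R. z < x) \<Longrightarrow> sorted_wrt (<) (R @ [x])"
  by (simp add: sorted_wrt_append)

text \<open>Turns the minimum over a set into a column \<open>c\<close> and the replacement into a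
  list update. An entry left of \<open>c\<close> that exceeded \<open>x\<close> would be a smaller
  candidate for bumping, and equality is excluded by \<open>x \<notin> set R\<close>.\<close>

lemma row_bump:
  assumes "sorted_wrt (<) R" "\<exists>z\<in>set R. x < z" "x \<notin> set R"
  obtains c where "c < length R" "R ! c = bump x R"
    "map (\<lambda>z. if z = bump x R then x else z) R = R[c := x]"
    "\<And>i. i < c \<Longrightarrow> R ! i < x" "\<And>i. c < i \<Longrightarrow> i < length R \<Longrightarrow> bump x R < R ! i"
    "sorted_wrt (<) (R[c := x])"
proof -
  obtain c where c: "c < length R" "R ! c = bump x R"
    using bump_in(1)[OF assms(2)] by (auto simp: in_set_conv_nth)
  have lt: "R ! i < R ! j" if "i < j" "j < length R" for i j
    using assms(1) that by (simp add: sorted_wrt_iff_nth_less)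
  have 1: "R ! i < x" if "i < c" for i
  proof (rule ccontr)
    assume n: "\<not> ?thesis"
    have "R ! i \<in> set R" using that c by simp
    then have "bump x R \<le> R ! i" using n assms(3) bump_le[of "R ! i" R x]
      by (metis linorder_neqE_nat)
    then show False using lt[OF that] c by simp
  qed
  have 2: "bump x R < R ! i" if "c < i" "i < length R" for i
    using lt[OF that] c by simp
  have x: "x < bump x R" using bump_in(2)[OF assms(2)] .
  have "R[c := x] ! i < R[c := x] ! j" if "i < j" "j < length R" for i j
  proof -
    consider "i = c" | "j = c" "i < c" | "i \<noteq> c" "j \<noteq> c" using \<open>i < j\<close> by (cases "i = c"; cases "j = c") auto
    then show ?thesis
      using that lt[OF that] 1[of i] 2[of j] x c(1) by cases auto
  qed
  then have "sorted_wrt (<) (R[c := x])" by (simp add: sorted_wrt_iff_nth_less)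
  moreover have "map (\<lambda>z. if z = bump x R then x else z) R = R[c := x]"
    using sorted_map_replace[OF assms(1) c(1)] c(2) by simp
  ultimately show ?thesis using that c 1 2 by blast
qed

text \<open>The bumped \<open>y\<close> lands in a column not right of \<open>c\<close>: if the next
  row has a box in column \<open>c\<close>, its entry exceeds \<open>y\<close>. Up to column
  \<open>c\<close> the updated upper row lies below \<open>y\<close>, and elsewhere the upper
  entries have not grown.\<close>

lemma dominates_rsk_insert:
  assumes "sorted_wrt (<) R" "dominates R T" "tableau_rows T"
    "c < length R" "R ! c = y" "x < y" "y \<notin> set (concat T)"
  shows "dominates (R[c := x]) (rsk_insert y T)"
proof (cases T)
  case Nil
  have "R[c := x] ! 0 < y" if "c \<noteq> 0"
    using that assms(1,4,5) by (auto simp: sorted_wrt_iff_nth_less)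
  then show ?thesis using Nil assms(4,6) by (cases R; cases c) auto
next
  case (Cons R2 T2)
  have lt: "R ! i < R ! j" if "i < j" "j < length R" for i j
    using assms(1) that by (simp add: sorted_wrt_iff_nth_less)
  have le: "R[c := x] ! i \<le> R ! i" for i
    using assms by (cases "i = c") auto
  have before: "R[c := x] ! i < y" if "i \<le> c" for i
    using that assms lt[of i c] by (cases "i = c") auto
  have len: "length R2 \<le> length R" and dom: "\<And>i. i < length R2 \<Longrightarrow> R ! i < R2 ! i"
    and sR2: "sorted_wrt (<) R2"
    using assms Cons by auto
  have dom': "R[c := x] ! i < R2 ! i" if "i < length R2" for i
    using le[of i] dom[OF that] by simp
  show ?thesis
  proof (cases "\<exists>z\<in>set R2. y < z")
    case True
    have "y \<notin> set R2" using assms Cons by auto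
    then obtain c2 where c2: "c2 < length R2"
      "map (\<lambda>z. if z = bump y R2 then y else z) R2 = R2[c2 := y]"
      "\<And>i. i < c2 \<Longrightarrow> R2 ! i < y"
      by (rule row_bump[OF sR2 True]) blast+
    have "c2 \<le> c"
    proof (rule ccontr)
      assume "\<not> ?thesis"
      then show False using c2(3)[of c] dom[of c] c2(1) assms(5) by simp
    qed
    then show ?thesis
      using c2 before[of c2] dom' len Cons True
      by (auto simp: rsk_insert_Cons nth_list_update)
  next
    case False
    have "length R2 \<le> c"
    proof (rule ccontr)
      assume "\<not> ?thesis"
      then have "y < R2 ! c" "R2 ! c \<in> set R2" using dom[of c] assms(5) by auto
      then show False using False by blast
    qed
    then show ?thesis
      using before[of "length R2"] dom' len Cons False assms(4)
      by (auto simp: rsk_insert_Cons nth_append less_Suc_eq)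
  qed
qed

text \<open>The induction applies to the lower rows because, by distinctness, the bumped entry does
  not occur there.\<close>

lemma tableau_rows_rsk_insert:
  assumes "tableau_rows T" "distinct (concat T)" "x \<notin> set (concat T)"
  shows "tableau_rows (rsk_insert x T)"
  using assms
proof (induction T arbitrary: x)
  case (Cons R T)
  show ?case
  proof (cases "\<exists>z\<in>set R. x < z")
    case True
    obtain c where c: "c < length R" "R ! c = bump x R"
      "map (\<lambda>z. if z = bump x R then x else z) R = R[c := x]"
      "sorted_wrt (<) (R[c := x])"
      by (rule row_bump[of R x]) (use Cons.prems True in auto)
    have nin: "bump x R \<notin> set (concat T)"
      using Cons.prems bump_in(1)[OF True] by auto
    have "tableau_rows (rsk_insert (bump x R) T)"
      using Cons nin by simp
    moreover have "dominates (R[c := x]) (rsk_insert (bump x R) T)"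
      using Cons.prems c bump_in(2)[OF True] nin
      by (intro dominates_rsk_insert[where y = "bump x R"]) auto
    moreover have "R[c := x] \<noteq> []" using c(1) by auto
    ultimately show ?thesis using c True by (simp add: rsk_insert_Cons)
  next
    case False
    have "x \<notin> set R" using Cons.prems by simp
    then have lt: "\<forall>z\<in>set R. z < x" using False by (metis linorder_neqE_nat)
    have "dominates (R @ [x]) T"
      using Cons.prems by (cases T) (auto simp: nth_append)
    then show ?thesis
      using False Cons.prems lt by (auto simp: rsk_insert_Cons intro!: sorted_wrt_snocI)
  qed
qed simp

lemma tableau_rsk_insert:
  assumes "tableau T" "x \<notin> entries T" "x \<noteq> 0"
  shows "tableau (rsk_insert x T)"
proof -
  have "0 \<notin> set (concat (rsk_insert x T))"
    unfolding set_concat_rsk_insert using assms by (auto simp: tableau_iff)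
  then show ?thesis
    using assms unfolding tableau_iff entries_conv_concat
    by (blast intro: tableau_rows_rsk_insert distinct_concat_rsk_insert)
qed

lemma entries_rsk_insert: "entries (rsk_insert x T) = insert x (entries T)"
  by (simp only: entries_conv_concat set_concat_rsk_insert)

section \<open>Injectivity and surjectivity of row insertion\<close>

text \<open>In the new row \<open>x\<close> lies below the evicted value, and all entries after
  \<open>x\<close> exceed that value. So the evicted value fixes the column, and with it both
  \<open>x\<close> and the old row.\<close>

lemma row_unbump_unique:
  assumes "sorted_wrt (<) R" "\<exists>z\<in>set R. x < z" "x \<notin> set R"
    "sorted_wrt (<) R'" "\<exists>z\<in>set R'. x' < z" "x' \<notin> set R'"
    "bump x R = bump x' R'"
    "map (\<lambda>z. if z = bump x R then x else z) R = map (\<lambda>z. if z = bump x' R' then x' else z) R'"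
  shows "x = x' \<and> R = R'"
proof -
  obtain c where c: "c < length R" "R ! c = bump x R"
    "map (\<lambda>z. if z = bump x R then x else z) R = R[c := x]"
    "\<And>i. i < c \<Longrightarrow> R ! i < x" "\<And>i. c < i \<Longrightarrow> i < length R \<Longrightarrow> bump x R < R ! i"
    "sorted_wrt (<) (R[c := x])"
    by (rule row_bump[OF assms(1-3)]) blast
  obtain d where d: "d < length R'" "R' ! d = bump x' R'"
    "map (\<lambda>z. if z = bump x' R' then x' else z) R' = R'[d := x']"
    "\<And>i. i < d \<Longrightarrow> R' ! i < x'" "\<And>i. d < i \<Longrightarrow> i < length R' \<Longrightarrow> bump x' R' < R' ! i"
    "sorted_wrt (<) (R'[d := x'])"
    by (rule row_bump[OF assms(4-6)]) blast
  have eq: "R[c := x] = R'[d := x']" using c(3) d(3) assms(8) by simp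
  then have len: "length R = length R'" by (metis length_list_update)
  have x: "x < bump x R" "x' < bump x' R'" using bump_in(2)[OF assms(2)] bump_in(2)[OF assms(5)] by auto
  have cd: "c = d"
  proof (rule linorder_cases[of c d])
    assume "c < d"
    then have "bump x R < R[c := x] ! d" using c(5)[of d] d(1) len by simp
    also have "\<dots> = x'" using eq d(1) by simp
    finally show ?thesis using x assms(7) by simp
  next
    assume "d < c"
    then have "bump x' R' < R'[d := x'] ! c" using d(5)[of c] c(1) len by simp
    also have "\<dots> = x" using eq c(1) by (metis nth_list_update_eq)
    finally show ?thesis using x assms(7) by simp
  qed
  have "x = x'" using eq cd c(1) len by (metis nth_list_update_eq)
  moreover have "R = (R[c := x])[c := bump x R]" using c(2) by (metis list_update_id list_update_overwrite)
  moreover have "R' = (R'[d := x'])[d := bump x' R']" using d(2) by (metis list_update_id list_update_overwrite)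
  ultimately show ?thesis using eq cd assms(7) by metis
qed

text \<open>Equal old shapes exclude the mixed cases, since a bumped row keeps its length and an
  extended one grows. If both first rows bump, the rows below determine the evicted value by
  induction, and \<open>row_unbump_unique\<close> recovers the first row from it.\<close>

lemma rsk_insert_inj_rows:
  assumes "tableau_rows T" "distinct (concat T)" "x \<notin> set (concat T)"
    "tableau_rows T'" "distinct (concat T')" "x' \<notin> set (concat T')"
    "shape T = shape T'" "rsk_insert x T = rsk_insert x' T'"
  shows "x = x' \<and> T = T'"
  using assms
proof (induction T arbitrary: x x' T')
  case Nil
  then show ?case by (cases T') auto
next
  case (Cons R T)
  obtain R' U where T': "T' = R' # U" "length R = length R'" "shape T = shape U"
    using Cons.prems(7) by (cases T') auto
  note prems = Cons.prems[unfolded T'(1)]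
  consider (both) "\<exists>z\<in>set R. x < z" "\<exists>z\<in>set R'. x' < z"
    | (none) "\<not> (\<exists>z\<in>set R. x < z)" "\<not> (\<exists>z\<in>set R'. x' < z)"
    | (left) "\<exists>z\<in>set R. x < z" "\<not> (\<exists>z\<in>set R'. x' < z)"
    | (right) "\<not> (\<exists>z\<in>set R. x < z)" "\<exists>z\<in>set R'. x' < z" by blast
  then show ?case
  proof cases
    case both
    have nin: "bump x R \<notin> set (concat T)" "bump x' R' \<notin> set (concat U)"
      using prems bump_in(1)[OF both(1)] bump_in(1)[OF both(2)] by auto
    have "rsk_insert x (R # T) =
        map (\<lambda>z. if z = bump x R then x else z) R # rsk_insert (bump x R) T"
      "rsk_insert x' (R' # U) =
        map (\<lambda>z. if z = bump x' R' then x' else z) R' # rsk_insert (bump x' R') U"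
      using both by (simp_all only: rsk_insert_Cons if_True)
    then have eq: "map (\<lambda>z. if z = bump x R then x else z) R =
        map (\<lambda>z. if z = bump x' R' then x' else z) R'"
      "rsk_insert (bump x R) T = rsk_insert (bump x' R') U"
      using prems(8) by (simp_all only: list.inject)
    have ih: "bump x R = bump x' R' \<and> T = U"
      by (rule Cons.IH) (use prems T'(3) nin eq(2) in simp_all)
    have "x = x' \<and> R = R'"
      by (rule row_unbump_unique[OF _ both(1) _ _ both(2) _ _ eq(1)]) (use prems ih in simp_all)
    then show ?thesis using ih T' by simp
  next
    case none
    then have "(R @ [x]) # T = (R' @ [x']) # U"
      using prems(8) by (simp only: rsk_insert_Cons if_False)
    then show ?thesis using T'(1) by simp
  next
    case left
    then have "map (\<lambda>z. if z = bump x R then x else z) R = R' @ [x']"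
      using prems(8) by (simp only: rsk_insert_Cons if_True if_False list.inject)
    from arg_cong[OF this, of length] show ?thesis using T'(2) by simp
  next
    case right
    then have "R @ [x] = map (\<lambda>z. if z = bump x' R' then x' else z) R'"
      using prems(8) by (simp only: rsk_insert_Cons if_True if_False list.inject)
    from arg_cong[OF this, of length] show ?thesis using T'(2) by simp
  qed
qed

lemma rsk_insert_inj:
  assumes "tableau T" "x \<notin> entries T" "tableau T'" "x' \<notin> entries T'"
    "shape T = shape T'" "rsk_insert x T = rsk_insert x' T'"
  shows "x = x' \<and> T = T'"
  by (rule rsk_insert_inj_rows) (use assms in \<open>simp_all only: tableau_iff entries_conv_concat not_False_eq_True\<close>)

text \<open>A single reverse bump: \<open>y\<close> takes the place of the largest entry
  \<open>z\<close> below it. No entry of \<open>R\<close> lies between \<open>z\<close> and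
  \<open>y\<close>, so inserting \<open>z\<close> again evicts exactly \<open>y\<close>.\<close>

lemma row_unbump:
  assumes "sorted_wrt (<) R" "\<exists>w\<in>set R. w < y" "y \<notin> set R"
  obtains c where "c < length R" "R ! c < y" "sorted_wrt (<) (R[c := y])"
    "\<And>i. i < length R \<Longrightarrow> R ! i < y \<Longrightarrow> i \<le> c"
    "bump (R ! c) (R[c := y]) = y" "R ! c \<notin> set (R[c := y])"
proof -
  define z where "z = Max {w \<in> set R. w < y}"
  have "z \<in> {w \<in> set R. w < y}"
    unfolding z_def using assms(2) by (intro Max_in) auto
  then obtain c where c: "c < length R" "R ! c = z" "z < y" by (auto simp: in_set_conv_nth)
  have zmax: "w \<le> z" if "w \<in> set R" "w < y" for w
    unfolding z_def using that by simp
  have lt: "R ! i < R ! j" if "i < j" "j < length R" for i j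
    using assms(1) that by (simp add: sorted_wrt_iff_nth_less)
  have before: "i \<le> c" if "i < length R" "R ! i < y" for i
  proof (rule ccontr)
    assume "\<not> ?thesis"
    then show False using lt[of c i] zmax[of "R ! i"] that c by simp
  qed
  have after: "y < R ! i" if "c < i" "i < length R" for i
  proof (rule ccontr)
    assume "\<not> ?thesis"
    moreover have "R ! i \<noteq> y" using assms(3) that by auto
    ultimately show False using before[of i] that by simp
  qed
  have "R[c := y] ! i < R[c := y] ! j" if "i < j" "j < length R" for i j
    using that lt[OF that] lt[of i c] after[of j] c by (cases "i = c"; cases "j = c") auto
  then have s: "sorted_wrt (<) (R[c := y])" by (simp add: sorted_wrt_iff_nth_less)
  have d: "distinct R" using assms(1) strict_sorted_iff by blast
  have set: "set (R[c := y]) = insert y (set R - {z})"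
    using c d by (simp add: set_update_distinct)
  have "bump z (R[c := y]) = y"
    unfolding bump_def set
  proof (rule Min_eqI)
    fix w assume "w \<in> {w \<in> insert y (set R - {z}). z < w}"
    then show "y \<le> w" using zmax[of w] by fastforce
  qed (use c in auto)
  then show ?thesis using that[of c] c s before set by auto
qed

text \<open>The conjunct \<open>x \<in> set (hd T)\<close> strengthens the induction. The value that
  leaves the lower rows stems from the topmost of them, so the entry above it is smaller and the
  current row has an entry to give up.\<close>

lemma rsk_insert_surj_rows:
  assumes "tableau_rows T" "distinct (concat T)" "is_partition mu" "r \<le> length mu"
    "shape T = add_box r mu"
  shows "\<exists>x S. tableau_rows S \<and> shape S = mu \<and> distinct (concat S) \<and> x \<notin> set (concat S) \<and>
    rsk_insert x S = T \<and> x \<in> set (hd T)"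
  using assms
proof (induction r mu arbitrary: T rule: add_box.induct)
  case (1 r)
  then obtain x where "T = [[x]]"
    by (cases T) (auto simp: shape_def length_Suc_conv)
  then show ?case by (intro exI[of _ x] exI[of _ "[]"]) simp
next
  case (2 p ps)
  obtain R Rs where T: "T = R # Rs" "length R = Suc p" "shape Rs = ps"
    using 2(5) by (cases T) auto
  define R0 x where "R0 = butlast R" and "x = last R"
  have R: "R = R0 @ [x]" using T unfolding R0_def x_def by (cases R) auto
  have p: "length R0 = p" "p > 0" using T 2(3) R by (auto simp: is_partition_Cons)
  have srt: "sorted_wrt (<) R0" "\<forall>z\<in>set R0. z < x"
    using 2(1) R T by (auto simp: sorted_wrt_append)
  have "dominates R0 Rs"
  proof (cases Rs)
    case (Cons Q Qs)
    then have len: "length Q \<le> length R0" using 2(3) T p by (auto simp: is_partition_Cons)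
    have "R ! c < Q ! c" if "c < length Q" for c using 2(1) T Cons that by simp
    then show ?thesis using Cons len R by (auto simp: nth_append)
  qed simp
  moreover have "rsk_insert x (R0 # Rs) = T"
    using srt T R by (auto simp: rsk_insert_Cons)
  ultimately show ?case
    using 2(1,2) T R p srt by (intro exI[of _ x] exI[of _ "R0 # Rs"]) auto
next
  case (3 r p ps)
  obtain R Rs where T: "T = R # Rs" "length R = p" "shape Rs = add_box r ps"
    using 3(6) by (cases T) auto
  have R: "sorted_wrt (<) R" "dominates R Rs" "distinct (concat Rs)"
      "set R \<inter> set (concat Rs) = {}" "tableau_rows Rs"
    using 3(2,3) T by auto
  obtain y S where S: "tableau_rows S" "shape S = ps" "distinct (concat S)"
    "y \<notin> set (concat S)" "rsk_insert y S = Rs" "y \<in> set (hd Rs)"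
    using 3(1)[of Rs] 3(4,5) T R by (auto simp: is_partition_Cons)
  obtain R2 Rs' where Rs: "Rs = R2 # Rs'"
    using T(3) by (cases Rs) (cases "(r, ps)" rule: add_box.cases; auto)+
  obtain d where d: "d < length R2" "R2 ! d = y" using S(6) Rs by (auto simp: in_set_conv_nth)
  have dom: "length R2 \<le> length R" "\<And>c. c < length R2 \<Longrightarrow> R ! c < R2 ! c"
    using R Rs by auto
  have R2: "sorted_wrt (<) R2" using R(5) Rs by simp
  have ex: "\<exists>w\<in>set R. w < y" using dom d nth_mem[of d R] by force
  have "y \<notin> set R" using R(4) S(6) Rs by auto
  then obtain c where c: "c < length R" "R ! c < y" "sorted_wrt (<) (R[c := y])"
    "\<And>i. i < length R \<Longrightarrow> R ! i < y \<Longrightarrow> i \<le> c"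
    "bump (R ! c) (R[c := y]) = y" "R ! c \<notin> set (R[c := y])"
    by (rule row_unbump[OF R(1) ex]) blast+
  \<comment> \<open>Column \<open>c\<close> is the last one whose entry in \<open>R\<close> is below
    \<open>y\<close>, and column \<open>d\<close> has such an entry.\<close>
  have dc: "d \<le> c" using c(4)[of d] dom d by auto
  \<comment> \<open>The upper row grows in column \<open>c\<close> only. There \<open>S\<close> has
    no box, or it holds the value evicted by \<open>y\<close> (if \<open>d = c\<close>), or a value
    to the right of \<open>y\<close> in \<open>R2\<close> (if \<open>d < c\<close>).\<close>
  have "dominates (R[c := y]) S"
  proof (cases S)
    case (Cons Q S')
    have len: "length Q \<le> length R" using 3(4) S(2) T(2) Cons by (auto simp: is_partition_Cons)
    have sQ: "sorted_wrt (<) Q" "y \<notin> set Q" using S Cons by auto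
    have "R[c := y] ! i < Q ! i" if i: "i < length Q" for i
    proof (cases "\<exists>z\<in>set Q. y < z")
      case True
      obtain e where e: "e < length Q" "Q ! e = bump y Q"
        "map (\<lambda>z. if z = bump y Q then y else z) Q = Q[e := y]"
        by (rule row_bump[OF sQ(1) True sQ(2)]) blast
      have R2': "R2 = Q[e := y]" using S(5) Cons Rs True e(3) by (simp add: rsk_insert_Cons)
      have "distinct R2" using R2 strict_sorted_iff by blast
      then have "d = e" using d e R2' by (metis length_list_update nth_eq_iff_index_eq nth_list_update_eq)
      have y: "y < Q ! e" using bump_in(2)[OF True] e by simp
      show ?thesis
      proof (cases "i = c")
        case True
        have "y < Q ! c" if "d < c"
          using that R2 d i True R2' \<open>d = e\<close>
          by (metis length_list_update nat_neq_iff nth_list_update_neq sorted_wrt_nth_less)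
        then show ?thesis using True y \<open>d = e\<close> dc c(1) by (cases "d = c") auto
      next
        case False
        have "R ! i < R2 ! i" using dom(2)[of i] i R2' by simp
        also have "R2 ! i \<le> Q ! i" using R2' y e by (cases "i = e") auto
        finally show ?thesis using False by simp
      qed
    next
      case False
      then have R2': "R2 = Q @ [y]" using S(5) Cons Rs by (simp add: rsk_insert_Cons)
      have "\<not> d < length Q" using d(2) sQ(2) R2' by (metis nth_append nth_mem)
      then have "i \<noteq> c" using dc i by simp
      then show ?thesis using dom(2)[of i] i R2' by (simp add: nth_append)
    qed
    then show ?thesis using Cons len by simp
  qed simp
  moreover have "rsk_insert (R ! c) (R[c := y] # S) = T"
  proof -
    have "\<exists>z\<in>set (R[c := y]). R ! c < z" using c set_update_memI[OF c(1)] by blast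
    moreover have "map (\<lambda>z. if z = y then R ! c else z) (R[c := y]) = R"
      using sorted_map_replace[OF c(3), of c "R ! c"] c(1) by simp
    ultimately show ?thesis using S(5) T(1) c(5) by (simp add: rsk_insert_Cons)
  qed
  moreover have conc: "set (concat Rs) = insert y (set (concat S))"
    using set_concat_rsk_insert[of y S] S(5) by simp
  moreover have "distinct (R[c := y])" using c(3) strict_sorted_iff by blast
  moreover have "set (R[c := y]) \<inter> set (concat S) = {}"
    using set_update_subset_insert[of R c y] R(4) S(4) conc by blast
  moreover have "R ! c \<in> set R" using c(1) by simp
  moreover have "R ! c \<notin> set (concat S)" using R(4) conc c(1) nth_mem by blast
  moreover have "R[c := y] \<noteq> []" using c(1) by auto
  ultimately show ?case
    using S c T by (intro exI[of _ "R ! c"] exI[of _ "R[c := y] # S"]) simp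
qed

lemma rsk_insert_surj:
  assumes "tableau T" "is_partition mu" "covers mu (shape T)"
  shows "\<exists>x S. tableau S \<and> shape S = mu \<and> x \<notin> entries S \<and> rsk_insert x S = T"
proof -
  obtain r where "r \<le> length mu" "shape T = add_box r mu" using assms(3) by (auto simp: covers_def)
  then obtain x S where S: "tableau_rows S" "shape S = mu" "distinct (concat S)"
    "x \<notin> set (concat S)" "rsk_insert x S = T"
    using rsk_insert_surj_rows[of T mu r] assms by (auto simp: tableau_iff)
  moreover have "0 \<notin> set (concat S)"
    using assms(1) set_concat_rsk_insert[of x S] S(5) unfolding tableau_iff by blast
  ultimately show ?thesis unfolding tableau_iff entries_conv_concat by blast
qed

section \<open>Jeu de taquin\<close>

definition north_west :: "nat \<times> nat \<Rightarrow> nat \<times> nat \<Rightarrow> bool" where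
  "north_west p q \<longleftrightarrow> fst p \<le> fst q \<and> snd p \<le> snd q \<and> p \<noteq> q"

definition next_box :: "nat \<times> nat \<Rightarrow> nat \<times> nat \<Rightarrow> bool" where
  "next_box p q \<longleftrightarrow> q = (Suc (fst p), snd p) \<or> q = (fst p, Suc (snd p))"

lemma north_west_trans: "north_west p q \<Longrightarrow> north_west q s \<Longrightarrow> north_west p s"
  by (cases p; cases q; cases s) (auto simp: north_west_def)

lemma north_west_irrefl [simp]: "\<not> north_west p p"
  by (simp add: north_west_def)

lemma next_box_north_west: "next_box p q \<Longrightarrow> north_west p q"
  by (cases p) (auto simp: north_west_def next_box_def)

lemma next_box_neq: "next_box p q \<Longrightarrow> p \<noteq> q"
  using next_box_north_west north_west_irrefl by metis

lemma down_closed_north_west: "down_closed D \<Longrightarrow> north_west p q \<Longrightarrow> q \<in> D \<Longrightarrow> p \<in> D"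
  by (cases p) (auto simp: down_closed_def north_west_def)

lemma north_west_first_step:
  assumes "north_west p q" obtains s where "next_box p s" "s = q \<or> north_west s q"
proof (cases "fst p < fst q")
  case True
  then have "(Suc (fst p), snd p) = q \<or> north_west (Suc (fst p), snd p) q" using assms by (auto simp: north_west_def)
  then show ?thesis using that by (auto simp: next_box_def)
next
  case False
  then have "(fst p, Suc (snd p)) = q \<or> north_west (fst p, Suc (snd p)) q"
    using assms by (cases p; cases q) (auto simp: north_west_def)
  then show ?thesis using that by (auto simp: next_box_def)
qed

lemma north_west_last_step:
  assumes "north_west p q" obtains s where "next_box s q" "p = s \<or> north_west p s"
proof (cases "fst p < fst q")
  case True
  then have "p = (fst q - 1, snd q) \<or> north_west p (fst q - 1, snd q)" "next_box (fst q - 1, snd q) q"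
    using assms by (cases p; cases q; auto simp: north_west_def next_box_def)+
  then show ?thesis using that by blast
next
  case False
  then have "p = (fst q, snd q - 1) \<or> north_west p (fst q, snd q - 1)" "next_box (fst q, snd q - 1) q"
    using assms by (cases p; cases q; auto simp: north_west_def next_box_def)+
  then show ?thesis using that by blast
qed

text \<open>All north-west pairs are compared, not just adjacent boxes: once one box is exempt, as
  during a slide, comparisons across that box need not follow from adjacent ones.\<close>

definition increasing :: "filling \<Rightarrow> bool" where
  "increasing T \<longleftrightarrow> (\<forall>p\<in>diagram (shape T). \<forall>q\<in>diagram (shape T). north_west p q \<longrightarrow> entry T p < entry T q)"

text \<open>Induction on the coordinate sum of \<open>q\<close>: the last box before
  \<open>q\<close> lies in the diagram, because Young diagrams are closed to the north-west.\<close>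

lemma increasing_if_next_box:
  assumes "is_partition (shape T)"
    "\<And>p q. q \<in> diagram (shape T) \<Longrightarrow> next_box p q \<Longrightarrow> entry T p < entry T q"
  shows "increasing T"
proof -
  have "entry T p < entry T q" if "north_west p q" "q \<in> diagram (shape T)" for p q
    using that
  proof (induction "fst q + snd q" arbitrary: q rule: less_induct)
    case less
    obtain s where s: "next_box s q" "p = s \<or> north_west p s" using north_west_last_step[OF less.prems(1)] .
    have "s \<in> diagram (shape T)"
      using down_closed_north_west[OF down_closed_diagram[OF assms(1)]] next_box_north_west s(1) less.prems(2) by blast
    moreover have "fst s + snd s < fst q + snd q" using s(1) by (auto simp: next_box_def)
    ultimately show ?case
      using s less.hyps[of s] assms(2)[OF less.prems(2) s(1)] by (auto intro: less_trans)
  qed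
  then show ?thesis by (simp add: increasing_def)
qed

lemma tableau_iff_increasing:
  "tableau T \<longleftrightarrow> is_partition (shape T) \<and> inj_on (entry T) (diagram (shape T)) \<and>
    0 \<notin> entries T \<and> increasing T"
proof -
  have "(\<forall>r c. (r, Suc c) \<in> diagram (shape T) \<longrightarrow> entry T (r, c) < entry T (r, Suc c)) \<and>
      (\<forall>r c. (Suc r, c) \<in> diagram (shape T) \<longrightarrow> entry T (r, c) < entry T (Suc r, c)) \<longleftrightarrow> increasing T"
    (is "?L \<longleftrightarrow> _") if part: "is_partition (shape T)"
  proof
    assume L: ?L show "increasing T"
      by (rule increasing_if_next_box[OF part]) (use L in \<open>auto simp: next_box_def\<close>)
  next
    assume inc: "increasing T"
    have "entry T p < entry T q" if "next_box p q" "q \<in> diagram (shape T)" for p q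
      using inc next_box_north_west[OF that(1)] down_closed_north_west[OF down_closed_diagram[OF part]] that(2)
      unfolding increasing_def by blast
    then show ?L by (simp add: next_box_def)
  qed
  then show ?thesis unfolding tableau_def partitions_iff by blast
qed

text \<open>
  The states met by a slide: only the entry at \<open>b\<close> may be smaller than entries to its north-west.
  Slides can be reversed on these states: the entry at \<open>b\<close> goes back to the larger of its left and
  upper neighbours as long as that one exceeds it.
\<close>

definition jdt_state :: "filling \<Rightarrow> nat \<times> nat \<Rightarrow> bool" where
  "jdt_state T b \<longleftrightarrow> is_partition (shape T) \<and> inj_on (entry T) (diagram (shape T)) \<and>
     b \<in> diagram (shape T) \<and>
     (\<forall>p\<in>diagram (shape T). \<forall>q\<in>diagram (shape T).
        north_west p q \<longrightarrow> p \<noteq> b \<longrightarrow> q \<noteq> b \<longrightarrow> entry T p < entry T q) \<and>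
     (\<forall>q\<in>diagram (shape T). north_west b q \<longrightarrow> entry T b < entry T q)"

text \<open>Taking the least successor treats moves down and to the right alike; if there is only
  one successor, the comparison is vacuous.\<close>

definition slide_step :: "filling \<Rightarrow> nat \<times> nat \<Rightarrow> nat \<times> nat \<Rightarrow> bool" where
  "slide_step T b b' \<longleftrightarrow> b' \<in> diagram (shape T) \<and> next_box b b' \<and>
     (\<forall>q\<in>diagram (shape T). next_box b q \<longrightarrow> q \<noteq> b' \<longrightarrow> entry T b' < entry T q)"

text \<open>Membership in the diagram is not asked for, since the left and upper neighbours of a box
  of a Young diagram belong to it.\<close>

definition unslide_step :: "filling \<Rightarrow> nat \<times> nat \<Rightarrow> nat \<times> nat \<Rightarrow> bool" where
  "unslide_step T b' b \<longleftrightarrow> next_box b b' \<and> entry T b' < entry T b \<and>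
     (\<forall>q. next_box q b' \<longrightarrow> q \<noteq> b \<longrightarrow> entry T q < entry T b)"

lemma entry_exchange:
  assumes "b \<in> diagram (shape T)" "b' \<in> diagram (shape T)" "b \<noteq> b'"
  shows "entry (exchange T b b') q = (if q = b then entry T b' else if q = b' then entry T b else entry T q)"
proof -
  obtain r c r' c' where b: "b = (r, c)" "b' = (r', c')" by (cases b; cases b')
  have bd: "r < length T" "c < length (T ! r)" "r' < length T" "c' < length (T ! r')"
    using assms by (auto simp: b mem_diagram shape_def)
  show ?thesis
    using bd assms(3)
    by (cases q; cases "r = r'") (auto simp: b entry_def exchange_def set_entry_def nth_list_update)
qed

lemma exchange_exchange:
  assumes "b \<in> diagram (shape T)" "b' \<in> diagram (shape T)" "b \<noteq> b'"
  shows "exchange (exchange T b b') b b' = T"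
  by (rule filling_eqI) (use assms in \<open>simp_all add: entry_exchange\<close>)

lemma inj_on_exchange:
  assumes "b \<in> diagram (shape T)" "b' \<in> diagram (shape T)" "b \<noteq> b'" "inj_on (entry T) (diagram (shape T))"
  shows "inj_on (entry (exchange T b b')) (diagram (shape T))"
  using assms(4) unfolding inj_on_def entry_exchange[OF assms(1-3)]
  using assms(1-3) by (auto split: if_splits)

lemma entries_exchange:
  assumes "b \<in> diagram (shape T)" "b' \<in> diagram (shape T)" "b \<noteq> b'"
  shows "entries (exchange T b b') = entries T"
proof -
  have sub: "entries (exchange U b b') \<subseteq> entries U" if "b \<in> diagram (shape U)" "b' \<in> diagram (shape U)" for U
    using that assms(3) by (auto simp: entries_def entry_exchange)
  show ?thesis
    using sub[OF assms(1,2)] sub[of "exchange T b b'"] exchange_exchange[OF assms] assms by auto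
qed

text \<open>The entry that moved up to \<open>b\<close> was the least successor, so it fits there.
  It also exceeds the other predecessor of \<open>b'\<close>, because the order in the old filling
  applied to both; this is why the backward step returns to \<open>b\<close>.\<close>

lemma slide_step_state:
  assumes "jdt_state T b" "slide_step T b b'"
  shows "jdt_state (exchange T b b') b'" "unslide_step (exchange T b b') b' b"
proof -
  let ?D = "diagram (shape T)" and ?T = "exchange T b b'"
  have st: "is_partition (shape T)" "inj_on (entry T) ?D" "b \<in> ?D"
    and mono: "\<And>p q. p \<in> ?D \<Longrightarrow> q \<in> ?D \<Longrightarrow> north_west p q \<Longrightarrow> p \<noteq> b \<Longrightarrow> q \<noteq> b \<Longrightarrow> entry T p < entry T q"
    and beyond: "\<And>q. q \<in> ?D \<Longrightarrow> north_west b q \<Longrightarrow> entry T b < entry T q"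
    using assms(1) unfolding jdt_state_def by blast+
  have b': "b' \<in> ?D" "next_box b b'" "b \<noteq> b'"
    and least: "\<And>q. q \<in> ?D \<Longrightarrow> next_box b q \<Longrightarrow> q \<noteq> b' \<Longrightarrow> entry T b' < entry T q"
    using assms(2) next_box_neq unfolding slide_step_def by blast+
  note dn = down_closed_north_west[OF down_closed_diagram[OF st(1)]]
  note e = entry_exchange[OF st(3) b'(1,3)]
  have nb: "north_west b b'" using next_box_north_west b'(2) .
  have mono': "entry ?T p < entry ?T q"
    if "p \<in> ?D" "q \<in> ?D" "north_west p q" "p \<noteq> b'" "q \<noteq> b'" for p q
  proof (cases "p = b")
    case True
    \<comment> \<open>A path from \<open>b\<close> to \<open>q\<close> begins with \<open>b'\<close>
      or with the other successor, whose entry is larger by the choice of \<open>b'\<close>.\<close>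
    obtain s where s: "next_box b s" "s = q \<or> north_west s q" using north_west_first_step[of p q] \<open>north_west p q\<close> True by blast
    have sD: "s \<in> ?D" using s(2) that(2) dn by blast
    have qb: "q \<noteq> b" using True that(3) by auto
    have "entry T b' < entry T q"
    proof (cases "s = b'")
      case True then show ?thesis using s mono[OF b'(1) that(2)] b'(3) qb that(5) by auto
    next
      case False
      then have "entry T b' < entry T s" using least sD s(1) by blast
      also have "entry T s \<le> entry T q"
        using s mono[OF sD that(2)] next_box_neq[OF s(1)] qb by (auto intro: less_imp_le)
      finally show ?thesis .
    qed
    then show ?thesis using True qb that(5) by (simp add: e)
  next
    case False
    show ?thesis
    proof (cases "q = b")
      case True
      then have "north_west p b'" using north_west_trans[OF that(3)] nb by simp
      then show ?thesis using mono[OF that(1) b'(1)] False True that(4) b'(3) by (simp add: e)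
    next
      case ne: False
      then show ?thesis using mono[OF that(1,2,3)] False that by (simp add: e)
    qed
  qed
  have beyond': "entry ?T b' < entry ?T q" if "q \<in> ?D" "north_west b' q" for q
  proof -
    have "north_west b q" using north_west_trans[OF nb that(2)] .
    moreover from this that have "q \<noteq> b" "q \<noteq> b'" by auto
    ultimately show ?thesis using beyond[OF that(1)] b'(3) by (simp add: e)
  qed
  show "jdt_state ?T b'"
    using st b' mono' beyond' inj_on_exchange[OF st(3) b'(1,3) st(2)]
    unfolding jdt_state_def shape_exchange by blast
  have "entry T q < entry T b'" if "next_box q b'" "q \<noteq> b" for q
  proof -
    have "north_west q b'" using next_box_north_west that(1) .
    moreover from this have "q \<in> ?D" using dn b'(1) by blast
    ultimately show ?thesis using mono[OF _ b'(1), of q] that(2) b'(3) by auto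
  qed
  moreover have "q \<noteq> b'" if "next_box q b'" for q using next_box_neq that by blast
  moreover have "entry T b < entry T b'" using beyond[OF b'(1) nb] .
  ultimately show "unslide_step ?T b' b" using b'(2,3) b'(3)[symmetric] by (simp add: unslide_step_def e)
qed

text \<open>Mirror image of the forward step: paths are cut at their last box, and maximality among
  predecessors replaces minimality among successors. The other successor of \<open>b\<close> exceeds
  the entry moved to \<open>b'\<close>, so the forward step chooses \<open>b'\<close> again.\<close>

lemma unslide_step_state:
  assumes "jdt_state T b'" "unslide_step T b' b"
  shows "jdt_state (exchange T b b') b" "slide_step (exchange T b b') b b'"
proof -
  let ?D = "diagram (shape T)" and ?T = "exchange T b b'"
  have st: "is_partition (shape T)" "inj_on (entry T) ?D" "b' \<in> ?D"
    and mono: "\<And>p q. p \<in> ?D \<Longrightarrow> q \<in> ?D \<Longrightarrow> north_west p q \<Longrightarrow> p \<noteq> b' \<Longrightarrow> q \<noteq> b' \<Longrightarrow> entry T p < entry T q"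
    and beyond: "\<And>q. q \<in> ?D \<Longrightarrow> north_west b' q \<Longrightarrow> entry T b' < entry T q"
    using assms(1) unfolding jdt_state_def by blast+
  note dn = down_closed_north_west[OF down_closed_diagram[OF st(1)]]
  have a: "next_box b b'" "entry T b' < entry T b"
    and greatest: "\<And>q. next_box q b' \<Longrightarrow> q \<noteq> b \<Longrightarrow> entry T q < entry T b"
    using assms(2) unfolding unslide_step_def by blast+
  have nb: "north_west b b'" and neq: "b \<noteq> b'" using next_box_north_west next_box_neq a(1) by blast+
  have bD: "b \<in> ?D" using dn[OF nb st(3)] .
  note e = entry_exchange[OF bD st(3) neq]
  have mono': "entry ?T p < entry ?T q"
    if "p \<in> ?D" "q \<in> ?D" "north_west p q" "p \<noteq> b" "q \<noteq> b" for p q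
  proof (cases "p = b'")
    case True
    then have "q \<noteq> b'" using that(3) by auto
    moreover have "north_west b q" using north_west_trans[OF nb] that(3) True by simp
    ultimately show ?thesis using mono[OF bD that(2)] True neq that(5) by (simp add: e)
  next
    case False
    show ?thesis
    proof (cases "q = b'")
      case True
      obtain s where s: "next_box s b'" "p = s \<or> north_west p s" using north_west_last_step[of p q] \<open>north_west p q\<close> True by blast
      have sD: "s \<in> ?D" using dn[OF next_box_north_west[OF s(1)] st(3)] .
      have "entry T p < entry T b"
      proof (cases "s = b")
        case True then show ?thesis using s mono[OF that(1) bD] that(4) False neq by auto
      next
        case ne: False
        have "entry T p \<le> entry T s"
          using s mono[OF that(1) sD] False next_box_neq[OF s(1)] by (auto intro: less_imp_le)
        also have "\<dots> < entry T b" using greatest[OF s(1) ne] .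
        finally show ?thesis .
      qed
      then show ?thesis using True False that(4) neq by (simp add: e)
    next
      case ne: False
      then show ?thesis using mono[OF that(1,2,3)] False that by (simp add: e)
    qed
  qed
  have larger: "entry T b < entry T q" if "q \<in> ?D" "north_west b q" "q \<noteq> b'" for q
    using mono[OF bD that(1,2)] neq that(3) by blast
  have beyond': "entry ?T b < entry ?T q" if "q \<in> ?D" "north_west b q" for q
  proof -
    have "q \<noteq> b" using that(2) by auto
    then show ?thesis using larger[OF that] a(2) neq by (auto simp: e)
  qed
  show "jdt_state ?T b"
    using st bD mono' beyond' inj_on_exchange[OF bD st(3) neq st(2)]
    unfolding jdt_state_def shape_exchange by blast
  have "entry T b < entry T q" if "q \<in> ?D" "next_box b q" "q \<noteq> b'" for q
    using larger that next_box_north_west by blast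
  moreover have "q \<noteq> b" if "next_box b q" for q using next_box_neq that by blast
  ultimately show "slide_step ?T b b'" using st(3) a(1) neq by (simp add: slide_step_def e)
qed

lemma jdt_slide_slide_step:
  assumes "jdt_state T b" "slide_step T b b'"
  shows "jdt_slide T (fst b) (snd b) = jdt_slide (exchange T b b') (fst b') (snd b')"
proof -
  obtain r c where b: "b = (r, c)" by (cases b)
  have "b' = (Suc r, c) \<or> b' = (r, Suc c)" using assms(2) by (auto simp: slide_step_def next_box_def b)
  then show ?thesis
  proof
    assume b': "b' = (Suc r, c)"
    then have "(Suc r, c) \<in> diagram (shape T)"
      "(r, Suc c) \<in> diagram (shape T) \<longrightarrow> entry T (Suc r, c) < entry T (r, Suc c)"
      using assms(2) by (auto simp: slide_step_def next_box_def b)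
    then show ?thesis by (subst jdt_slide.simps) (simp add: b b' del: jdt_slide.simps)
  next
    assume b': "b' = (r, Suc c)"
    then have "(r, Suc c) \<in> diagram (shape T)"
      "(Suc r, c) \<in> diagram (shape T) \<longrightarrow> \<not> entry T (Suc r, c) < entry T (r, Suc c)"
      using assms(2) by (auto simp: slide_step_def next_box_def b)
    then show ?thesis by (subst jdt_slide.simps) (auto simp add: b b' simp del: jdt_slide.simps)
  qed
qed

lemma jdt_slide_corner:
  assumes "\<And>q. next_box b q \<Longrightarrow> q \<notin> diagram (shape T)"
  shows "jdt_slide T (fst b) (snd b) = delete_corner T (fst b)"
  using assms[of "(Suc (fst b), snd b)"] assms[of "(fst b, Suc (snd b))"]
  by (subst jdt_slide.simps) (simp add: next_box_def del: jdt_slide.simps)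

declare jdt_slide.simps [simp del]

text \<open>Injectivity excludes ties, so the minimum is strict, as \<open>slide_step\<close>
  demands.\<close>

lemma slide_step_exists:
  assumes "inj_on (entry T) (diagram (shape T))" "next_box b q" "q \<in> diagram (shape T)"
  shows "\<exists>b'. slide_step T b b'"
proof -
  let ?A = "{q \<in> diagram (shape T). next_box b q}"
  have fin: "finite ?A" "?A \<noteq> {}" using assms by (simp, blast)
  define b' where "b' = arg_min_on (entry T) ?A"
  have b': "b' \<in> ?A" unfolding b'_def by (rule arg_min_if_finite[OF fin])
  have "entry T b' < entry T s" if "s \<in> ?A" "s \<noteq> b'" for s
  proof -
    have "entry T b' \<le> entry T s" unfolding b'_def by (rule arg_min_least[OF fin that(1)])
    moreover have "entry T b' \<noteq> entry T s" using assms(1) that b' by (auto dest: inj_onD)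
    ultimately show ?thesis by simp
  qed
  then show ?thesis using b' by (intro exI[of _ b']) (auto simp: slide_step_def)
qed

lemma unslide_step_exists:
  assumes "jdt_state T b'" "next_box q b'" "entry T b' < entry T q"
  shows "\<exists>b. unslide_step T b' b"
proof -
  let ?A = "{q. next_box q b'}"
  have dn: "q \<in> diagram (shape T)" if "next_box q b'" for q
    using assms(1) down_closed_north_west[OF down_closed_diagram] next_box_north_west[OF that] unfolding jdt_state_def by blast
  have inj: "inj_on (entry T) (diagram (shape T))" using assms(1) by (simp add: jdt_state_def)
  have fin: "finite (entry T ` ?A)" "entry T ` ?A \<noteq> {}"
    using dn assms(2) by (blast intro: finite_imageI finite_subset[OF _ finite_diagram[of "shape T"]])+
  then have "Max (entry T ` ?A) \<in> entry T ` ?A" by (rule Max_in)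
  then obtain b where b: "next_box b b'" "entry T b = Max (entry T ` ?A)" by auto
  have le: "entry T s \<le> entry T b" if "next_box s b'" for s
    unfolding b(2) using fin(1) that by (intro Max_ge) auto
  have "entry T s < entry T b" if "next_box s b'" "s \<noteq> b" for s
  proof -
    have "entry T s \<noteq> entry T b" using inj_onD[OF inj] dn that b(1) by blast
    then show ?thesis using le[OF that(1)] by simp
  qed
  moreover have "entry T b' < entry T b" using le[OF assms(2)] assms(3) by simp
  ultimately show ?thesis using b(1) unfolding unslide_step_def by blast
qed

section \<open>Reversal of complete slides\<close>

text \<open>Pairs lead from the state after a step to the state before it. The box is recorded
  because the filling alone need not reveal which entry is moving.\<close>

definition slide_back :: "((filling \<times> (nat \<times> nat)) \<times> (filling \<times> (nat \<times> nat))) set" where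
  "slide_back = {((exchange T b b', b'), (T, b)) | T b b'. jdt_state T b \<and> slide_step T b b'}"

text \<open>If two predecessor boxes qualified, each would hold a smaller entry than the other. Once
  the box is known, exchanging again restores the earlier filling.\<close>

lemma single_valued_slide_back: "single_valued slide_back"
proof (rule single_valuedI)
  fix x y z assume xy: "(x, y) \<in> slide_back" and xz: "(x, z) \<in> slide_back"
  obtain T1 b1 b' where 1: "x = (exchange T1 b1 b', b')" "y = (T1, b1)"
    "jdt_state T1 b1" "slide_step T1 b1 b'"
    using xy unfolding slide_back_def by blast
  obtain T2 b2 c' where 2: "x = (exchange T2 b2 c', c')" "z = (T2, b2)"
    "jdt_state T2 b2" "slide_step T2 b2 c'"
    using xz unfolding slide_back_def by blast
  have eq: "(exchange T1 b1 b', b') = (exchange T2 b2 c', c')" using trans[OF sym[OF 1(1)] 2(1)] .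
  have c': "c' = b'" using arg_cong[OF eq, of snd] by (simp only: snd_conv)
  have ex: "exchange T1 b1 b' = exchange T2 b2 b'"
    using arg_cong[OF eq, of fst] unfolding c' fst_conv .
  have bs: "unslide_step (exchange T1 b1 b') b' b1" using slide_step_state(2)[OF 1(3,4)] .
  have bs': "unslide_step (exchange T1 b1 b') b' b2"
    unfolding ex using slide_step_state(2)[OF 2(3,4)] unfolding c' .
  have b: "b1 = b2"
  proof (rule ccontr)
    assume ne: "b1 \<noteq> b2"
    have "entry (exchange T1 b1 b') b1 < entry (exchange T1 b1 b') b2"
      using bs bs' ne unfolding unslide_step_def by blast
    moreover have "entry (exchange T1 b1 b') b2 < entry (exchange T1 b1 b') b1"
      using bs bs' ne unfolding unslide_step_def by blast
    ultimately show False by (rule less_asym)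
  qed
  have inv: "exchange (exchange T b b') b b' = T" if "jdt_state T b" "slide_step T b b'" for T b
  proof (rule exchange_exchange)
    show "b \<in> diagram (shape T)" using that(1) by (simp only: jdt_state_def)
    show "b' \<in> diagram (shape T)" using that(2) by (simp only: slide_step_def)
    show "b \<noteq> b'" by (rule next_box_neq) (use that(2) in \<open>simp only: slide_step_def\<close>)
  qed
  have "T1 = exchange (exchange T2 b2 b') b1 b'"
    using inv[OF 1(3,4)] unfolding ex c' by (rule sym)
  also have "\<dots> = T2" unfolding b using inv[OF 2(3) 2(4)[unfolded c']] .
  finally have "T1 = T2" .
  then show "y = z" unfolding 1(2) 2(2) b by (rule arg_cong)
qed

text \<open>Retains the filling \<open>U\<close> reached just before the corner is dropped, which is
  where the reversal starts. The induction measure is the one that terminates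
  \<open>jdt_slide\<close>.\<close>

lemma jdt_slide_final:
  assumes "jdt_state T b"
  shows "\<exists>U s. ((U, s), (T, b)) \<in> slide_back\<^sup>* \<and> jdt_state U s \<and>
    (\<forall>q. next_box s q \<longrightarrow> q \<notin> diagram (shape U)) \<and>
    jdt_slide T (fst b) (snd b) = delete_corner U (fst s) \<and>
    shape U = shape T \<and> entries U = entries T \<and> entry U s = entry T b"
  using assms
proof (induction "length (shape T) + sum_list (shape T) - (fst b + snd b)"
    arbitrary: T b rule: less_induct)
  case less
  have st: "inj_on (entry T) (diagram (shape T))" "b \<in> diagram (shape T)"
    using less.prems by (auto simp: jdt_state_def)
  show ?case
  proof (cases "\<exists>q. next_box b q \<and> q \<in> diagram (shape T)")
    case False
    then show ?thesis
      using less.prems jdt_slide_corner[of b T] by (intro exI[of _ T] exI[of _ b]) blast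
  next
    case True
    then obtain b' where b': "slide_step T b b'" using slide_step_exists st(1) by blast
    then have b'': "b' \<in> diagram (shape T)" "next_box b b'" by (auto simp: slide_step_def)
    let ?T = "exchange T b b'"
    have "length (shape ?T) + sum_list (shape ?T) - (fst b' + snd b') <
        length (shape T) + sum_list (shape T) - (fst b + snd b)"
      using diagram_bound[of "fst b'" "snd b'" "shape T"] b'' by (auto simp: next_box_def)
    from less.hyps[OF this slide_step_state(1)[OF less.prems b']]
    obtain U s where U: "((U, s), (?T, b')) \<in> slide_back\<^sup>*" "jdt_state U s"
      "\<forall>q. next_box s q \<longrightarrow> q \<notin> diagram (shape U)"
      "jdt_slide ?T (fst b') (snd b') = delete_corner U (fst s)"
      "shape U = shape ?T" "entries U = entries ?T" "entry U s = entry ?T b'" by blast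
    have "((?T, b'), (T, b)) \<in> slide_back" using less.prems b' unfolding slide_back_def by blast
    then have "((U, s), (T, b)) \<in> slide_back\<^sup>*" using U(1) by (rule rtrancl_into_rtrancl[rotated])
    moreover have "jdt_slide T (fst b) (snd b) = delete_corner U (fst s)"
      using U(4) jdt_slide_slide_step[OF less.prems b'] by simp
    moreover have "entries U = entries T" "entry U s = entry T b"
      using U(6,7) next_box_neq[OF b''(2)] entries_exchange[OF st(2) b''(1)]
        entry_exchange[OF st(2) b''(1)] by simp_all
    moreover have "shape U = shape T" using U(5) by simp
    ultimately show ?thesis using U(2,3) by blast
  qed
qed

text \<open>Backward steps lower the coordinate sum of the moving box, so they end; when none is
  left, the exempt entry fits its place. Each backward step leaves the outcome of the forward slide
  unchanged.\<close>

lemma jdt_slide_origin: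
  assumes "jdt_state U s"
  shows "\<exists>T b. jdt_state T b \<and> increasing T \<and> jdt_slide T (fst b) (snd b) = jdt_slide U (fst s) (snd s) \<and>
    shape T = shape U \<and> entries T = entries U \<and> entry T b = entry U s"
  using assms
proof (induction "fst s + snd s" arbitrary: U s rule: less_induct)
  case less
  have st: "is_partition (shape U)" "inj_on (entry U) (diagram (shape U))" "s \<in> diagram (shape U)"
    and mono: "\<And>p q. p \<in> diagram (shape U) \<Longrightarrow> q \<in> diagram (shape U) \<Longrightarrow> north_west p q \<Longrightarrow>
      p \<noteq> s \<Longrightarrow> q \<noteq> s \<Longrightarrow> entry U p < entry U q"
    and beyond: "\<And>q. q \<in> diagram (shape U) \<Longrightarrow> north_west s q \<Longrightarrow> entry U s < entry U q"
    using less.prems unfolding jdt_state_def by blast+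
  note dn = down_closed_north_west[OF down_closed_diagram[OF st(1)]]
  show ?case
  proof (cases "\<exists>q. next_box q s \<and> entry U s < entry U q")
    case True
    then obtain b where b: "unslide_step U s b" using unslide_step_exists less.prems by blast
    then have b': "next_box b s" by (simp add: unslide_step_def)
    then have neq: "b \<noteq> s" and bD: "b \<in> diagram (shape U)"
      using next_box_neq dn[OF next_box_north_west st(3)] by blast+
    let ?T = "exchange U b s"
    note st' = unslide_step_state[OF less.prems b]
    have "fst b + snd b < fst s + snd s" using b' by (auto simp: next_box_def)
    from less.hyps[OF this st'(1)] obtain T b0 where T: "jdt_state T b0" "increasing T"
      "jdt_slide T (fst b0) (snd b0) = jdt_slide ?T (fst b) (snd b)"
      "shape T = shape ?T" "entries T = entries ?T" "entry T b0 = entry ?T b" by blast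
    have "jdt_slide ?T (fst b) (snd b) = jdt_slide U (fst s) (snd s)"
      using jdt_slide_slide_step[OF st'] exchange_exchange[OF bD st(3) neq] by simp
    then show ?thesis
      using T neq entries_exchange[OF bD st(3) neq] entry_exchange[OF bD st(3) neq]
      by (intro exI[of _ T] exI[of _ b0]) simp
  next
    case False
    \<comment> \<open>Into \<open>s\<close> the inequality is the stopping condition, made strict by
      injectivity; out of \<open>s\<close> it is the second order condition of the state.\<close>
    have "entry U p < entry U q" if "q \<in> diagram (shape U)" "next_box p q" for p q
    proof -
      have n: "north_west p q" "p \<in> diagram (shape U)" "p \<noteq> q"
        using that dn next_box_north_west next_box_neq by blast+
      show ?thesis
      proof (cases "q = s")
        case True
        then have "entry U p \<noteq> entry U s" using inj_onD[OF st(2) _ n(2) st(3)] n(3) by blast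
        then show ?thesis using True False that(2) by (metis linorder_neqE_nat)
      next
        case ne: False
        then show ?thesis using mono[OF n(2) that(1) n(1)] beyond[OF that(1)] n(1) by (cases "p = s") auto
      qed
    qed
    then have "increasing U" using increasing_if_next_box[OF st(1)] by blast
    then show ?thesis using less.prems by blast
  qed
qed

section \<open>Adding and removing a corner\<close>

fun put_entry :: "nat \<Rightarrow> nat \<Rightarrow> filling \<Rightarrow> filling" where
  "put_entry x r [] = [[x]]"
| "put_entry x 0 (R # T) = (R @ [x]) # T"
| "put_entry x (Suc r) (R # T) = R # put_entry x r T"

definition new_box :: "nat \<Rightarrow> nat list \<Rightarrow> nat \<times> nat" where
  "new_box r mu = (r, if r < length mu then mu ! r else 0)"

lemma shape_put_entry [simp]: "shape (put_entry x r T) = add_box r (shape T)"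
  by (induction x r T rule: put_entry.induct) auto

lemma entry_put_entry:
  assumes "r \<le> length T"
  shows "entry (put_entry x r T) (new_box r (shape T)) = x"
    "p \<in> diagram (shape T) \<Longrightarrow> entry (put_entry x r T) p = entry T p"
proof -
  show "entry (put_entry x r T) (new_box r (shape T)) = x"
    using assms
  proof (induction x r T rule: put_entry.induct)
    case (3 x r R T)
    then show ?case by (auto simp: entry_def new_box_def split: if_splits)
  qed (auto simp: entry_def new_box_def shape_def)
next
  have "entry (put_entry x r T) (i, j) = entry T (i, j)" if "(i, j) \<in> diagram (shape T)" for i j
    using assms that
  proof (induction x r T arbitrary: i rule: put_entry.induct)
    case (2 x R T)
    then show ?case by (cases i) (auto simp: entry_def mem_diagram nth_append)
  next
    case (3 x r R T)
    then show ?case by (cases i) (auto simp: entry_def mem_diagram_Cons)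
  qed (simp add: mem_diagram)
  then show "p \<in> diagram (shape T) \<Longrightarrow> entry (put_entry x r T) p = entry T p" by (cases p) blast
qed

lemma diagram_add_new_box:
  "r \<le> length mu \<Longrightarrow> diagram (add_box r mu) = insert (new_box r mu) (diagram mu)"
  "new_box r mu \<notin> diagram mu"
  by (simp_all add: diagram_add_box new_box_def mem_diagram)

text \<open>\<open>delete_corner\<close> filters out every empty row, so \<open>T\<close> has to be
  free of them beforehand.\<close>

lemma delete_corner_put_entry:
  assumes "[] \<notin> set T" "r \<le> length T"
  shows "delete_corner (put_entry x r T) r = T"
  using assms
proof (induction x r T rule: put_entry.induct)
  case (2 x R T)
  then have "filter (\<lambda>R. R \<noteq> []) T = T" by (intro filter_True) auto
  then show ?case using 2 by (auto simp: delete_corner_def)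
qed (auto simp: delete_corner_def)

lemma hd_put_entry:
  "S \<noteq> [] \<Longrightarrow> length (hd S) \<le> length (hd (put_entry x r S)) \<and> put_entry x r S \<noteq> []"
  by (cases "(x, r, S)" rule: put_entry.cases) simp_all

text \<open>No box lies below a corner, so shortening its row keeps the parts weakly decreasing. A
  corner in column 0 forms the last row by itself, and that row disappears.\<close>

lemma put_entry_at_corner:
  assumes "is_partition (shape U)" "(r, c) \<in> diagram (shape U)"
    "(r, Suc c) \<notin> diagram (shape U)" "(Suc r, c) \<notin> diagram (shape U)"
  shows "\<exists>S. put_entry (entry U (r, c)) r S = U \<and> r \<le> length S \<and> is_partition (shape S)"
  using assms
proof (induction U arbitrary: r)
  case (Cons R U)
  have parts: "length R > 0" "U \<noteq> [] \<Longrightarrow> length (hd U) \<le> length R" "is_partition (shape U)"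
    using Cons.prems(1) by (cases U; auto simp: is_partition_Cons)+
  show ?case
  proof (cases r)
    case 0
    have len: "length R = Suc c" using Cons.prems 0 by (auto simp: mem_diagram_Cons)
    have ne: "R \<noteq> []" using len by auto
    have e: "entry (R # U) (r, c) = last R" using last_conv_nth[OF ne] len 0 by (simp add: entry_def)
    have next_row: "U \<noteq> [] \<Longrightarrow> length (hd U) \<le> c"
      using Cons.prems(4) 0 by (cases U) (auto simp: mem_diagram)
    show ?thesis
    proof (cases "c = 0")
      case True
      then have "U = []" using next_row parts(3) by (cases U) (auto simp: is_partition_Cons)
      moreover have "R = [last R]" using len True by (cases R) auto
      ultimately show ?thesis using e 0 by (intro exI[of _ "[]"]) auto
    next
      case False
      have "R = butlast R @ [last R]" using parts(1) by simp
      moreover have "is_partition (shape (butlast R # U))"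
        using False len next_row parts(3) by (cases U) (auto simp: is_partition_Cons)
      ultimately show ?thesis using e 0 by (intro exI[of _ "butlast R # U"]) simp
    qed
  next
    case (Suc r')
    obtain S where S: "put_entry (entry U (r', c)) r' S = U" "r' \<le> length S" "is_partition (shape S)"
      using Cons.IH[of r'] Cons.prems Suc parts(3) by (auto simp: mem_diagram_Cons)
    have e: "entry (R # U) (r, c) = entry U (r', c)" using Suc by (simp add: entry_def)
    have "S \<noteq> [] \<Longrightarrow> length (hd S) \<le> length (hd U) \<and> U \<noteq> []"
      using hd_put_entry[of S "entry U (r', c)" r'] unfolding S(1) .
    then have "is_partition (shape (R # S))"
      using parts S(3) by (cases S) (auto simp: is_partition_Cons)
    then show ?thesis using S e Suc by (intro exI[of _ "R # S"]) simp
  qed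
qed (simp add: mem_diagram)

lemma tableau_nonempty_rows: "is_partition (shape T) \<Longrightarrow> [] \<notin> set T"
  by (auto simp: is_partition_def shape_def)

text \<open>The invariant exempts only the moving entry, so deleting that entry from a corner leaves
  a tableau.\<close>

lemma jdt_state_corner:
  assumes "jdt_state U s" "\<And>q. next_box s q \<Longrightarrow> q \<notin> diagram (shape U)"
    "0 \<notin> entries U"
  obtains S r where "put_entry (entry U s) r S = U" "r \<le> length S" "s = new_box r (shape S)"
    "tableau S" "entries S = entries U - {entry U s}" "delete_corner U (fst s) = S"
proof -
  have st: "is_partition (shape U)" "inj_on (entry U) (diagram (shape U))" "s \<in> diagram (shape U)"
    and mono: "\<And>p q. p \<in> diagram (shape U) \<Longrightarrow> q \<in> diagram (shape U) \<Longrightarrow> north_west p q \<Longrightarrow>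
      p \<noteq> s \<Longrightarrow> q \<noteq> s \<Longrightarrow> entry U p < entry U q"
    using assms(1) unfolding jdt_state_def by blast+
  obtain r c where s: "s = (r, c)" by (cases s)
  have next_box: "(r, Suc c) \<notin> diagram (shape U)" "(Suc r, c) \<notin> diagram (shape U)"
    using assms(2) s by (auto simp: next_box_def)
  obtain S where S: "put_entry (entry U s) r S = U" "r \<le> length S" "is_partition (shape S)"
    using put_entry_at_corner[OF st(1) st(3)[unfolded s] next_box] s by blast
  have shU: "shape U = add_box r (shape S)" using S(1) shape_put_entry by metis
  have D: "diagram (shape U) = insert (new_box r (shape S)) (diagram (shape S))"
    unfolding shU using S(2) by (intro diagram_add_new_box) simp
  \<comment> \<open>If \<open>s\<close> lay further left in row \<open>r\<close>, its right
    neighbour would belong to \<open>U\<close>, contrary to the choice of \<open>s\<close> as a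
    corner.\<close>
  have "s = new_box r (shape S)"
  proof (rule ccontr)
    assume ne: "s \<noteq> new_box r (shape S)"
    then have "s \<in> diagram (shape S)" using st(3) D by blast
    then have "c < shape S ! r" "r < length S" by (auto simp: s mem_diagram)
    then have "(r, Suc c) \<in> diagram (shape U)"
      unfolding D new_box_def by (cases "Suc c = shape S ! r") (auto simp: mem_diagram)
    then show False using next_box by blast
  qed
  note snb = this
  have DS: "diagram (shape S) = diagram (shape U) - {s}"
    using D diagram_add_new_box(2)[of r "shape S"] snb by blast
  have eS: "entry S p = entry U p" if "p \<in> diagram (shape S)" for p
    using entry_put_entry(2)[OF S(2) that, of "entry U s"] S(1) by simp
  have "entries S = entry U ` (diagram (shape U) - {s})"
    unfolding entries_def using eS DS by (intro image_cong) auto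
  also have "\<dots> = entries U - {entry U s}"
    unfolding entries_def using st by (subst inj_on_image_set_diff[OF st(2)]) auto
  finally have entS: "entries S = entries U - {entry U s}" .
  have inj: "inj_on (entry S) (diagram (shape S))"
    using st(2) eS DS by (subst inj_on_cong[of _ _ "entry U"]) (auto intro: inj_on_subset)
  have "increasing S"
    unfolding increasing_def using mono eS DS by auto
  then have "tableau S"
    unfolding tableau_iff_increasing using S(3) inj entS assms(3) by blast
  moreover have "delete_corner U (fst s) = S"
    using delete_corner_put_entry[OF tableau_nonempty_rows[OF S(3)] S(2), of "entry U s"] S(1) s by simp
  ultimately show ?thesis using that S snb entS by blast
qed

section \<open>Injectivity and surjectivity of deletion\<close>

lemma jdt_state_tableau:
  "tableau T \<Longrightarrow> b \<in> diagram (shape T) \<Longrightarrow> jdt_state T b"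
  unfolding tableau_iff_increasing jdt_state_def increasing_def by blast

lemma jdt_delete_eq:
  assumes "inj_on (entry T) (diagram (shape T))" "b \<in> diagram (shape T)"
  shows "jdt_delete (entry T b) T = jdt_slide T (fst b) (snd b)"
proof -
  have "(THE b'. b' \<in> diagram (shape T) \<and> entry T b' = entry T b) = b"
    using assms by (intro the_equality) (auto dest: inj_onD)
  then show ?thesis by (simp add: jdt_delete_def Let_def)
qed

text \<open>Exposes what reversal depends on: the row \<open>r\<close> of the lost corner, and the
  chain of backward steps that starts with \<open>x\<close> placed in it.\<close>

lemma jdt_delete_final:
  assumes "tableau T" "x \<in> entries T"
  obtains b U r where "b \<in> diagram (shape T)" "entry T b = x"
    "((U, new_box r (shape (jdt_delete x T))), (T, b)) \<in> slide_back\<^sup>*"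
    "U = put_entry x r (jdt_delete x T)" "shape T = add_box r (shape (jdt_delete x T))"
    "r \<le> length (jdt_delete x T)"
    "tableau (jdt_delete x T)" "entries (jdt_delete x T) = entries T - {x}"
proof -
  obtain b where b: "b \<in> diagram (shape T)" "entry T b = x" using assms(2) by (auto simp: entries_def)
  have inj: "inj_on (entry T) (diagram (shape T))" using assms(1) by (simp add: tableau_def)
  have del: "jdt_delete x T = jdt_slide T (fst b) (snd b)" using jdt_delete_eq[OF inj b(1)] b(2) by simp
  obtain U s where U: "((U, s), (T, b)) \<in> slide_back\<^sup>*" "jdt_state U s"
    "\<forall>q. next_box s q \<longrightarrow> q \<notin> diagram (shape U)"
    "jdt_slide T (fst b) (snd b) = delete_corner U (fst s)"
    "shape U = shape T" "entries U = entries T" "entry U s = entry T b"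
    using jdt_slide_final[OF jdt_state_tableau[OF assms(1) b(1)]] by blast
  have zero: "0 \<notin> entries U" using assms(1) U(6) by (simp add: tableau_def)
  obtain S r where S: "put_entry (entry U s) r S = U" "r \<le> length S" "s = new_box r (shape S)"
    "tableau S" "entries S = entries U - {entry U s}" "delete_corner U (fst s) = S"
    by (rule jdt_state_corner[OF U(2) _ zero]) (use U(3) in blast)+
  have SS: "jdt_delete x T = S" using S(6) U(4) del by (simp only:)
  have e: "entry U s = x" using U(7) b(2) by (simp only:)
  show ?thesis
  proof (rule that[of b U r, unfolded SS])
    show "((U, new_box r (shape S)), (T, b)) \<in> slide_back\<^sup>*" using U(1) S(3) by (simp only:)
    show "U = put_entry x r S" using S(1) unfolding e by (rule sym)
    show "shape T = add_box r (shape S)"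
      using arg_cong[OF S(1), of shape] U(5) by (simp only: shape_put_entry)
    show "entries S = entries T - {x}" using S(5) e U(6) by (simp only:)
  qed (use b S in simp_all)
qed

lemma tableau_jdt_delete:
  assumes "tableau T" "x \<in> entries T"
  shows "tableau (jdt_delete x T)" "entries (jdt_delete x T) = entries T - {x}"
    "covers (shape (jdt_delete x T)) (shape T)"
  using jdt_delete_final[OF assms] by (metis covers_def length_shape)+

lemma add_box_index_inj:
  assumes "add_box r mu = add_box r' mu" "r \<le> length mu" "r' \<le> length mu"
  shows "r = r'"
proof -
  have "insert (new_box r mu) (diagram mu) = insert (new_box r' mu) (diagram mu)"
    using assms diagram_add_new_box(1) by metis
  then have "new_box r mu = new_box r' mu" using diagram_add_new_box(2) by blast
  then show ?thesis by (simp add: new_box_def)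
qed

text \<open>A backward step needs a left or upper neighbour with a larger entry, which a tableau
  does not have. So tableaux are end points of backward chains.\<close>

lemma no_back_step_tableau:
  assumes "tableau T" "((T, b), (U, s)) \<in> slide_back\<^sup>*"
  shows "(T, b) = (U, s)"
  using assms(2)
proof (cases rule: converse_rtranclE)
  case (step y)
  then obtain T' b' where st: "jdt_state T' b'" "slide_step T' b' b" "T = exchange T' b' b"
    unfolding slide_back_def by blast
  have "unslide_step T b b'" "b \<in> diagram (shape T)"
    using slide_step_state[OF st(1,2)] st by (auto simp: jdt_state_def)
  moreover have "north_west b' b" using \<open>unslide_step T b b'\<close> next_box_north_west by (auto simp: unslide_step_def)
  moreover have "b' \<in> diagram (shape T)"
    using down_closed_north_west[OF down_closed_diagram[OF tableau_partition[OF assms(1)]]] calculation by blast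
  ultimately show ?thesis
    using assms(1) unfolding tableau_iff_increasing increasing_def unslide_step_def
    by (meson less_asym)
qed simp

text \<open>The common shape fixes \<open>r\<close>, so both deletions pass through the same filling
  with \<open>x\<close> in the same corner. As backward steps are single-valued, one of the two
  chains from there continues the other, and since both stop at tableaux they stop at the same
  one.\<close>

lemma jdt_delete_inj:
  assumes "tableau T" "x \<in> entries T" "tableau T'" "x \<in> entries T'"
    "shape T = shape T'" "jdt_delete x T = jdt_delete x T'"
  shows "T = T'"
proof -
  let ?S = "jdt_delete x T"
  obtain b U r where 1: "((U, new_box r (shape ?S)), (T, b)) \<in> slide_back\<^sup>*"
    "U = put_entry x r ?S" "shape T = add_box r (shape ?S)" "r \<le> length ?S"
    using jdt_delete_final[OF assms(1,2)] by metis
  obtain b' U' r' where 2: "((U', new_box r' (shape ?S)), (T', b')) \<in> slide_back\<^sup>*"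
    "U' = put_entry x r' ?S" "shape T' = add_box r' (shape ?S)" "r' \<le> length ?S"
    using jdt_delete_final[OF assms(3,4)] assms(6) by metis
  have "r = r'" using add_box_index_inj 1(3,4) 2(3,4) assms(5) by (metis length_shape)
  then have "((U, new_box r (shape ?S)), (T', b')) \<in> slide_back\<^sup>*" using 1(2) 2(1,2) by simp
  from single_valued_confluent[OF single_valued_slide_back 1(1) this]
  show ?thesis using no_back_step_tableau assms(1,3) by blast
qed

text \<open>With \<open>x\<close> in the added corner the order conditions of a state hold whatever
  its value: nothing lies to the south-east, and all other pairs come from \<open>S\<close>.
  \<open>jdt_slide_origin\<close> then provides the tableau.\<close>

lemma jdt_delete_surj:
  assumes "tableau S" "x \<notin> entries S" "x \<noteq> 0" "is_partition lam" "covers (shape S) lam"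
  shows "\<exists>T. tableau T \<and> shape T = lam \<and> entries T = insert x (entries S) \<and> jdt_delete x T = S"
proof -
  obtain r where r: "r \<le> length S" "lam = add_box r (shape S)"
    using assms(5) by (auto simp: covers_def)
  define U s where "U = put_entry x r S" and "s = new_box r (shape S)"
  have S: "is_partition (shape S)" "inj_on (entry S) (diagram (shape S))" "0 \<notin> entries S" "increasing S"
    using assms(1) by (simp_all add: tableau_iff_increasing)
  have sh: "shape U = lam" using r by (simp add: U_def)
  have D: "diagram lam = insert s (diagram (shape S))" "s \<notin> diagram (shape S)"
    using r diagram_add_new_box[of r "shape S"] by (simp_all add: s_def)
  have e: "entry U s = x" "\<And>p. p \<in> diagram (shape S) \<Longrightarrow> entry U p = entry S p"
    using entry_put_entry[OF r(1)] by (simp_all add: U_def s_def)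
  have entU: "entries U = insert x (entries S)"
    unfolding entries_def sh D(1) using e by auto
  have "x \<notin> entry U ` diagram (shape S)" using assms(2) e(2) by (auto simp: entries_def)
  moreover have "inj_on (entry U) (diagram (shape S))" using S(2) e(2) inj_on_cong by metis
  ultimately have inj: "inj_on (entry U) (diagram lam)"
    unfolding D(1) using e(1) D(2) by (simp add: inj_on_insert)
  have max: "\<not> north_west s q" if "q \<in> diagram lam" for q
  proof
    assume q: "north_west s q"
    then have "q \<in> diagram (shape S)" using that D by auto
    then have "s \<in> diagram (shape S)" using down_closed_north_west[OF down_closed_diagram[OF S(1)] q] by blast
    then show False using D(2) by blast
  qed
  have mono: "entry U p < entry U q"
    if "p \<in> diagram lam" "q \<in> diagram lam" "north_west p q" "p \<noteq> s" "q \<noteq> s" for p q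
    using that S(4) D(1) e(2) unfolding increasing_def by auto
  have st: "jdt_state U s"
    unfolding jdt_state_def sh using assms(4) inj D(1) mono max by blast
  obtain T b where T: "jdt_state T b" "increasing T"
    "jdt_slide T (fst b) (snd b) = jdt_slide U (fst s) (snd s)"
    "shape T = shape U" "entries T = entries U" "entry T b = entry U s"
    using jdt_slide_origin[OF st] by blast
  have T': "is_partition (shape T)" "inj_on (entry T) (diagram (shape T))" "b \<in> diagram (shape T)"
    using T(1) by (simp_all add: jdt_state_def)
  have "tableau T"
    unfolding tableau_iff_increasing using T' T(2,5) entU S(3) assms(3) by simp
  moreover have "jdt_delete x T = S"
  proof -
    have "jdt_delete x T = jdt_slide U (fst s) (snd s)"
      using jdt_delete_eq[OF T'(2,3)] T(3,6) e(1) by simp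
    also have "\<dots> = delete_corner U (fst s)"
      by (rule jdt_slide_corner, unfold sh) (use max next_box_north_west in blast)
    also have "\<dots> = S"
      using delete_corner_put_entry[OF tableau_nonempty_rows[OF S(1)] r(1)]
      by (simp add: U_def s_def new_box_def)
    finally show ?thesis .
  qed
  ultimately show ?thesis using T(4,5) sh entU by auto
qed

section \<open>Runs of the delete-insert map\<close>

definition standard :: "nat \<Rightarrow> filling \<Rightarrow> bool" where
  "standard n T \<longleftrightarrow> tableau T \<and> entries T = {1..n}"

lemma tableau_card_entries: "tableau T \<Longrightarrow> card (entries T) = sum_list (shape T)"
  by (simp add: tableau_def card_entries_if_inj)

lemma standard_sum_list: "standard n T \<Longrightarrow> sum_list (shape T) = n"
  using tableau_card_entries[of T] by (simp add: standard_def)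

lemma SYT_iff_standard: "T \<in> SYT lam \<longleftrightarrow> standard (sum_list lam) T \<and> shape T = lam"
  by (auto simp: SYT_def standard_def)

lemma delete_insert_step:
  assumes "standard n T" "x \<in> {1..n}"
  shows "tableau (jdt_delete x T)" "entries (jdt_delete x T) = {1..n} - {x}"
    "covers (shape (jdt_delete x T)) (shape T)"
    "sum_list (shape (jdt_delete x T)) = n - 1"
    "standard n (rsk_insert x (jdt_delete x T))"
    "covers (shape (jdt_delete x T)) (shape (rsk_insert x (jdt_delete x T)))"
proof -
  have T: "tableau T" "x \<in> entries T" using assms by (simp_all add: standard_def)
  show 1: "tableau (jdt_delete x T)" "entries (jdt_delete x T) = {1..n} - {x}"
    "covers (shape (jdt_delete x T)) (shape T)"
    using tableau_jdt_delete[OF T] assms by (simp_all add: standard_def)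
  show "sum_list (shape (jdt_delete x T)) = n - 1"
    using tableau_card_entries[OF 1(1)] 1(2) assms(2) by simp
  have "x \<notin> entries (jdt_delete x T)" "x \<noteq> 0" using 1(2) assms(2) by auto
  then show "standard n (rsk_insert x (jdt_delete x T))"
    using tableau_rsk_insert[OF 1(1)] entries_rsk_insert 1(2) assms(2) by (auto simp: standard_def)
  show "covers (shape (jdt_delete x T)) (shape (rsk_insert x (jdt_delete x T)))"
    by (rule covers_rsk_insert)
qed

text \<open>The offset \<open>j\<close> makes tails of vacillating tableaux again instances of the same notion.\<close>

definition vacillating :: "nat \<Rightarrow> nat \<Rightarrow> nat \<Rightarrow> nat list list \<Rightarrow> bool" where
  "vacillating n j k P \<longleftrightarrow> length P = 2 * k + 1 \<and>
     (\<forall>i<Suc k. P ! (2 * i) \<in> Lam n (j + i)) \<and>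
     (\<forall>i<k. P ! (2 * i + 1) \<in> Lam (n - 1) (j + i)) \<and>
     (\<forall>i<k. covers (P ! (2 * i + 1)) (P ! (2 * i))) \<and>
     (\<forall>i<k. covers (P ! (2 * i + 1)) (P ! (2 * i + 2)))"

text \<open>The diagram conditions translate into \<open>covers\<close> only for partitions; the
  memberships in \<open>Lam\<close>, assumed locally as \<open>L\<close>, supply this.\<close>

lemma VT_iff_vacillating:
  "P \<in> VT k lam \<longleftrightarrow>
    vacillating (sum_list lam) 0 k P \<and> P ! 0 = [sum_list lam] \<and> P ! (2 * k) = lam"
proof -
  let ?n = "sum_list lam"
  have "(\<forall>i<k. diagram (P ! (2 * i + 1)) \<subseteq> diagram (P ! (2 * i)) \<and>
            card (diagram (P ! (2 * i)) - diagram (P ! (2 * i + 1))) = 1) \<longleftrightarrow>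
        (\<forall>i<k. covers (P ! (2 * i + 1)) (P ! (2 * i)))"
       "(\<forall>i<k. diagram (P ! (2 * i + 1)) \<subseteq> diagram (P ! (2 * i + 2)) \<and>
            card (diagram (P ! (2 * i + 2)) - diagram (P ! (2 * i + 1))) = 1) \<longleftrightarrow>
        (\<forall>i<k. covers (P ! (2 * i + 1)) (P ! (2 * i + 2)))"
    if L: "\<forall>i<Suc k. P ! (2 * i) \<in> Lam ?n i" "\<forall>i<k. P ! (2 * i + 1) \<in> Lam (?n - 1) i"
  proof -
    have p: "is_partition (P ! (2 * i))" "is_partition (P ! (2 * i + 1))"
      "is_partition (P ! (2 * i + 2))" if "i < k" for i
      using L(1)[rule_format, of i] L(1)[rule_format, of "Suc i"] L(2)[rule_format, of i] that
      by (simp_all add: Lam_iff)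
    show "(\<forall>i<k. diagram (P ! (2 * i + 1)) \<subseteq> diagram (P ! (2 * i)) \<and>
            card (diagram (P ! (2 * i)) - diagram (P ! (2 * i + 1))) = 1) \<longleftrightarrow>
        (\<forall>i<k. covers (P ! (2 * i + 1)) (P ! (2 * i)))"
       "(\<forall>i<k. diagram (P ! (2 * i + 1)) \<subseteq> diagram (P ! (2 * i + 2)) \<and>
            card (diagram (P ! (2 * i + 2)) - diagram (P ! (2 * i + 1))) = 1) \<longleftrightarrow>
        (\<forall>i<k. covers (P ! (2 * i + 1)) (P ! (2 * i + 2)))"
      using covers_iff_diagram[OF p(2) p(1)] covers_iff_diagram[OF p(2) p(3)] by blast+
  qed
  then show ?thesis
    unfolding VT_def vacillating_def mem_Collect_eq less_Suc_eq_le add_0 by blast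
qed

lemma vacillating_0: "vacillating n j 0 P \<longleftrightarrow> (\<exists>a. P = [a] \<and> a \<in> Lam n j)"
  by (cases P) (auto simp: vacillating_def)

text \<open>One round uses up two list entries but raises the index by one, which the offset
  absorbs.\<close>

lemma vacillating_Suc:
  "vacillating n j (Suc k) (a # b # P) \<longleftrightarrow> a \<in> Lam n j \<and> b \<in> Lam (n - 1) j \<and>
    covers b a \<and> covers b (P ! 0) \<and> vacillating n (Suc j) k P"
  unfolding vacillating_def All_less_Suc2[of k] All_less_Suc2[of "Suc k"] by auto

lemma run_hd: "delete_insert_run T xs = T # tl (delete_insert_run T xs)"
  by (cases xs) (auto simp: Let_def)

lemma run_nonempty [simp]: "delete_insert_run T xs \<noteq> []"
  by (subst run_hd) simp

lemma length_run: "length (delete_insert_run T xs) = 2 * length xs + 1"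
  by (induction xs arbitrary: T) (auto simp: Let_def)

text \<open>The start is any standard tableau with at most \<open>j\<close> boxes below its first
  row, because the tail of a run need not start from a single row.\<close>

lemma run_vacillating:
  assumes "standard n T" "set xs \<subseteq> {1..n}" "sum_list (tl (shape T)) \<le> j"
  shows "vacillating n j (length xs) (map shape (delete_insert_run T xs)) \<and>
    standard n (last (delete_insert_run T xs))"
  using assms
proof (induction xs arbitrary: T j)
  case Nil
  then show ?case
    by (auto simp: vacillating_0 Lam_iff standard_sum_list standard_def tableau_partition)
next
  case (Cons x xs)
  let ?H = "jdt_delete x T" and ?T = "rsk_insert x (jdt_delete x T)"
  have x: "x \<in> {1..n}" using Cons.prems by simp
  note step = delete_insert_step[OF Cons.prems(1) x]
  have a: "shape T \<in> Lam n j"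
    using Cons.prems by (simp add: Lam_iff standard_sum_list standard_def tableau_partition)
  have H: "shape ?H \<in> Lam (n - 1) j"
    using step sum_list_tl_covers(1)[OF step(3)] Cons.prems(3) by (simp add: Lam_iff tableau_partition)
  have "sum_list (tl (shape ?T)) \<le> Suc j"
    using sum_list_tl_covers(2)[OF step(6)] H by (simp add: Lam_iff)
  then have IH: "vacillating n (Suc j) (length xs) (map shape (delete_insert_run ?T xs)) \<and>
      standard n (last (delete_insert_run ?T xs))"
    using Cons.IH[OF step(5)] Cons.prems(2) by simp
  have "map shape (delete_insert_run ?T xs) ! 0 = shape ?T"
    by (subst run_hd) simp
  then show ?case using a H step(3,6) IH by (simp add: Let_def vacillating_Suc)
qed

text \<open>Recovery proceeds from the end: the induction hypothesis gives equality after the first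
  round, injectivity of insertion then identifies \<open>x\<close> and the half-step tableau, and
  for this common \<open>x\<close> injectivity of deletion applies.\<close>

lemma run_inj:
  assumes "standard n T" "set xs \<subseteq> {1..n}" "standard n T'" "set xs' \<subseteq> {1..n}"
    "length xs = length xs'"
    "map shape (delete_insert_run T xs) = map shape (delete_insert_run T' xs')"
    "last (delete_insert_run T xs) = last (delete_insert_run T' xs')"
  shows "T = T' \<and> xs = xs'"
  using assms
proof (induction xs arbitrary: T T' xs')
  case Nil
  then show ?case by simp
next
  case (Cons x xs)
  obtain x' ys where xs': "xs' = x' # ys" "length xs = length ys"
    using Cons.prems(5) by (cases xs') auto
  let ?H = "jdt_delete x T" and ?H' = "jdt_delete x' T'"
  have x: "x \<in> {1..n}" "x' \<in> {1..n}" using Cons.prems(2,4) xs' by auto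
  note step = delete_insert_step[OF Cons.prems(1) x(1)]
  note step' = delete_insert_step[OF Cons.prems(3) x(2)]
  have shapes: "shape T = shape T'" "shape ?H = shape ?H'"
    "map shape (delete_insert_run (rsk_insert x ?H) xs) = map shape (delete_insert_run (rsk_insert x' ?H') ys)"
    using Cons.prems(6) by (simp_all add: xs'(1) Let_def)
  have last: "last (delete_insert_run (rsk_insert x ?H) xs) = last (delete_insert_run (rsk_insert x' ?H') ys)"
    using Cons.prems(7) by (simp add: xs'(1) Let_def)
  have sub: "set xs \<subseteq> {1..n}" "set ys \<subseteq> {1..n}" using Cons.prems(2,4) xs'(1) by auto
  have IH: "rsk_insert x ?H = rsk_insert x' ?H' \<and> xs = ys"
    by (rule Cons.IH[OF step(5) sub(1) step'(5) sub(2) xs'(2) shapes(3) last])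
  have nin: "x \<notin> entries ?H" "x' \<notin> entries ?H'" using step(2) step'(2) by auto
  have H: "x = x' \<and> ?H = ?H'"
    by (rule rsk_insert_inj[OF step(1) nin(1) step'(1) nin(2) shapes(2) conjunct1[OF IH]])
  have in_T: "x \<in> entries T" "x \<in> entries T'"
    using Cons.prems(1,3) x(1) by (simp_all add: standard_def)
  have "jdt_delete x T = jdt_delete x T'" using H by metis
  then have "T = T'"
    using jdt_delete_inj[OF _ in_T(1) _ in_T(2) shapes(1)] Cons.prems(1,3) by (simp add: standard_def)
  then show ?case using IH H xs'(1) by simp
qed

text \<open>The induction builds the later rounds and leaves their starting tableau open, so that
  one more round can be put in front.\<close>

lemma run_surj:
  assumes "vacillating n j k P" "standard n U" "shape U = last P"
  shows "\<exists>T xs. standard n T \<and> set xs \<subseteq> {1..n} \<and> length xs = k \<and>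
    map shape (delete_insert_run T xs) = P \<and> last (delete_insert_run T xs) = U"
  using assms
proof (induction k arbitrary: j P)
  case 0
  then show ?case
    by (intro exI[of _ U] exI[of _ "[]"]) (auto simp: vacillating_0)
next
  case (Suc k)
  have len: "length P = Suc (Suc (2 * k + 1))" using Suc.prems(1) by (simp add: vacillating_def)
  then obtain a b Q where P: "P = a # b # Q" by (auto simp: length_Suc_conv)
  have v: "a \<in> Lam n j" "b \<in> Lam (n - 1) j" "covers b a" "covers b (Q ! 0)" "vacillating n (Suc j) k Q"
    using Suc.prems(1) by (simp_all add: P vacillating_Suc)
  have "Q \<noteq> []" using len P by auto
  then have "shape U = last Q" using Suc.prems(3) by (simp add: P)
  then obtain T1 xs where T1: "standard n T1" "set xs \<subseteq> {1..n}" "length xs = k"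
    "map shape (delete_insert_run T1 xs) = Q" "last (delete_insert_run T1 xs) = U"
    using Suc.IH[OF v(5) Suc.prems(2)] by blast
  have "Q ! 0 = shape T1" unfolding T1(4)[symmetric] by (subst run_hd) simp
  then obtain x H where H: "tableau H" "shape H = b" "x \<notin> entries H" "rsk_insert x H = T1"
    using rsk_insert_surj[of T1 b] v(2,4) T1(1) by (auto simp: standard_def Lam_iff)
  \<comment> \<open>Reverse insertion only yields some \<open>x\<close>; comparing entries
    identifies it as the number in \<open>{1..n}\<close> missing from \<open>H\<close>.\<close>
  have ins: "insert x (entries H) = {1..n}"
    using entries_rsk_insert[of x H] H(4) T1(1) by (simp add: standard_def)
  then have x: "x \<in> {1..n}" by blast
  then have x0: "x \<noteq> 0" by simp
  have cov: "covers (shape H) a" "is_partition a" using v(1,3) H(2) by (simp_all add: Lam_iff)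
  obtain T where T: "tableau T" "shape T = a" "entries T = insert x (entries H)" "jdt_delete x T = H"
    using jdt_delete_surj[OF H(1,3) x0 cov(2,1)] by blast
  show ?case
    using T ins x T1 H by (intro exI[of _ T] exI[of _ "x # xs"]) (simp add: standard_def P Let_def)
qed

lemma standard_one_row:
  assumes "n \<ge> 1"
  shows "standard n T \<and> shape T = [n] \<longleftrightarrow> T = [[1..<Suc n]]"
proof
  assume T: "standard n T \<and> shape T = [n]"
  then obtain R where R: "T = [R]" by (auto simp: shape_def)
  have "sorted_wrt (<) R" "set R = {1..n}"
    using T by (auto simp: R standard_def tableau_iff entries_conv_concat)
  moreover have "sorted_wrt (<) [1..<Suc n]" "set [1..<Suc n] = {1..n}"
    by (simp_all only: sorted_wrt_upt set_upt atLeastLessThanSuc_atLeastAtMost)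
  ultimately show "T = [[1..<Suc n]]"
    unfolding R using strict_sorted_equal by metis
next
  assume "T = [[1..<Suc n]]"
  moreover have "[1..<Suc n] \<noteq> []" using assms by simp
  ultimately show "standard n T \<and> shape T = [n]"
    by (auto simp: standard_def tableau_iff entries_conv_concat simp del: upt_Suc)
qed

section \<open>The bijection and the count\<close>

lemma bij_betw_delete_insert:
  assumes "n \<ge> 1"
  shows "bij_betw (delete_insert n) {xs. length xs = k \<and> (\<forall>i\<in>set xs. 1 \<le> i \<and> i \<le> n)}
    (SIGMA lam:Lam n k. SYT lam \<times> VT k lam)"
proof -
  let ?T0 = "[[1..<Suc n]]" and ?A = "{xs. length xs = k \<and> (\<forall>i\<in>set xs. 1 \<le> i \<and> i \<le> n)}"
  let ?run = "delete_insert_run ?T0"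
  have T0: "standard n ?T0" "shape ?T0 = [n]" using standard_one_row[OF assms] by blast+
  have A: "xs \<in> ?A \<longleftrightarrow> length xs = k \<and> set xs \<subseteq> {1..n}" for xs by auto
  have di: "delete_insert n xs = (shape (last (?run xs)), last (?run xs), map shape (?run xs))" for xs
    by (simp only: delete_insert_def Let_def)
  have inj: "inj_on (delete_insert n) ?A"
  proof (rule inj_onI)
    fix xs ys assume xs: "xs \<in> ?A" and ys: "ys \<in> ?A" and eq: "delete_insert n xs = delete_insert n ys"
    have e: "map shape (?run xs) = map shape (?run ys)" "last (?run xs) = last (?run ys)"
      using eq by (simp_all only: di prod.inject)
    have "length xs = length ys" "set xs \<subseteq> {1..n}" "set ys \<subseteq> {1..n}"
      using xs ys unfolding A by simp_all
    then show "xs = ys" using run_inj[OF T0(1) _ T0(1) _ _ e] by blast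
  qed
  have into: "delete_insert n xs \<in> (SIGMA lam:Lam n k. SYT lam \<times> VT k lam)" if "xs \<in> ?A" for xs
  proof -
    let ?P = "map shape (?run xs)" and ?U = "last (?run xs)"
    have xs: "length xs = k" "set xs \<subseteq> {1..n}" using that unfolding A by blast+
    have v: "vacillating n 0 k ?P" and U: "standard n ?U"
      using run_vacillating[OF T0(1) xs(2), of 0] T0(2) xs(1) by simp_all
    have P0: "?P ! 0 = [n]" by (subst run_hd) (simp only: list.map nth_Cons_0 T0(2))
    have Pk: "?P ! (2 * k) = shape ?U"
      using length_run[of ?T0 xs] xs(1) by (simp add: last_conv_nth del: upt_Suc)
    have n: "sum_list (shape ?U) = n" using standard_sum_list[OF U] .
    have "shape ?U \<in> Lam n k"
      using v Pk unfolding vacillating_def by (metis add_0 lessI)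
    moreover have "?U \<in> SYT (shape ?U)" unfolding SYT_iff_standard n using U by simp
    moreover have "?P \<in> VT k (shape ?U)" unfolding VT_iff_vacillating n using v P0 Pk by simp
    ultimately show ?thesis unfolding di by blast
  qed
  have onto: "\<exists>xs\<in>?A. delete_insert n xs = (lam, U, P)"
    if lam: "lam \<in> Lam n k" and U: "U \<in> SYT lam" and P: "P \<in> VT k lam" for lam U P
  proof -
    have n: "sum_list lam = n" using lam by (simp add: Lam_iff)
    have U': "standard n U" "shape U = lam" using U by (simp_all add: SYT_iff_standard n)
    have P': "vacillating n 0 k P" "P ! 0 = [n]" "P ! (2 * k) = lam"
      using P by (simp_all add: VT_iff_vacillating n)
    have "length P = 2 * k + 1" using P'(1) by (simp add: vacillating_def)
    then have "last P = lam" using P'(3) by (subst last_conv_nth) auto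
    then obtain T xs where T: "standard n T" "set xs \<subseteq> {1..n}" "length xs = k"
      "map shape (delete_insert_run T xs) = P" "last (delete_insert_run T xs) = U"
      using run_surj[OF P'(1) U'(1)] U'(2) by blast
    \<comment> \<open>\<open>run_surj\<close> leaves the starting tableau open; the first shape of
      \<open>P\<close> pins it down.\<close>
    have "shape T = [n]"
      using P'(2) unfolding T(4)[symmetric] by (subst (asm) run_hd) simp
    then have "T = ?T0" using standard_one_row[OF assms] T(1) by blast
    then have "delete_insert n xs = (lam, U, P)" using T(4,5) U'(2) unfolding di by simp
    moreover have "xs \<in> ?A" unfolding A using T(2,3) by simp
    ultimately show ?thesis by blast
  qed
  have "delete_insert n ` ?A = (SIGMA lam:Lam n k. SYT lam \<times> VT k lam)"
  proof (rule equalityI)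
    show "delete_insert n ` ?A \<subseteq> (SIGMA lam:Lam n k. SYT lam \<times> VT k lam)"
      using into by (rule image_subsetI)
    show "(SIGMA lam:Lam n k. SYT lam \<times> VT k lam) \<subseteq> delete_insert n ` ?A"
    proof
      fix y assume "y \<in> (SIGMA lam:Lam n k. SYT lam \<times> VT k lam)"
      then obtain lam U P where y: "y = (lam, U, P)" "lam \<in> Lam n k" "U \<in> SYT lam" "P \<in> VT k lam"
        by blast
      obtain xs where "xs \<in> ?A" "delete_insert n xs = y" using onto[OF y(2-4)] y(1) by blast
      then show "y \<in> delete_insert n ` ?A" by blast
    qed
  qed
  with inj show ?thesis unfolding bij_betw_def by blast
qed

theorem theorem3p1:
  fixes k n :: nat
  assumes "k \<ge> 1" and "n \<ge> 2 * k"
  shows "bij_betw (delete_insert n)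
           {xs. length xs = k \<and> (\<forall>i\<in>set xs. 1 \<le> i \<and> i \<le> n)}
           (SIGMA lam:Lam n k. SYT lam \<times> VT k lam)
         \<and> n ^ k = (\<Sum>lam\<in>Lam n k. card (SYT lam) * card (VT k lam))"
proof -
  let ?A = "{xs. length xs = k \<and> (\<forall>i\<in>set xs. 1 \<le> i \<and> i \<le> n)}"
  let ?B = "SIGMA lam:Lam n k. SYT lam \<times> VT k lam"
  have bij: "bij_betw (delete_insert n) ?A ?B" using assms by (intro bij_betw_delete_insert) simp
  have A: "?A = {xs. set xs \<subseteq> {1..n} \<and> length xs = k}" by auto
  have "finite ?A" unfolding A by (rule finite_lists_length_eq) simp
  then have fin: "finite ?B" using bij_betw_finite[OF bij] by simp
  \<comment> \<open>Each fibre lies in the image of the finite disjoint union under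
    \<open>snd\<close>, so its finiteness is inherited from the bijection.\<close>
  have fibres: "finite (SYT lam \<times> VT k lam)" if "lam \<in> Lam n k" for lam
    by (rule finite_subset[OF _ finite_imageI[OF fin, of snd]]) (use that in force)
  have "n ^ k = card ?A" unfolding A by (simp add: card_lists_length_eq)
  also have "\<dots> = card ?B" by (rule bij_betw_same_card[OF bij])
  also have "\<dots> = (\<Sum>lam\<in>Lam n k. card (SYT lam \<times> VT k lam))"
    using finite_Lam fibres by (intro card_SigmaI) auto
  finally show ?thesis using bij by (simp add: card_cartesian_product)
qed

end
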